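(* Let $X\subset\mathbb R^n$ be a zero-dimensional compact set, $n\geqslant2$. Suppose that $\dim p_\Pi(X)=0$ for some plane $\Pi\subset\mathbb R^n$ whose dimension equals $1$, $2$, $n-2$ or $n-1$. Then $X$ is tame.
   Context: A plane in $\mathbb R^n$ is an affine subspace; $p_\Pi:\mathbb R^n\to\Pi$ is the orthogonal projection onto $\Pi$. $\dim$ is topological (covering) dimension. A zero-dimensional compact set $K\subset\mathbb R^n$ is called tame if there exists a homeomorphism $h$ of $\mathbb R^n$ onto itself such that $h(K)$ is a subset of a straight line in $\mathbb R^n$. *)

theory Defs
  imports "HOL-Analysis.Analysis"
begin

text \<open>
  Lebesgue covering dimension of a topological space. The library predicate
  \<^const>\<open>dimension_le\<close> is the small inductive dimension. The value \<open>-1\<close>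
  is attained exactly by the empty space: for \<open>n = -1\<close> the last clause forces every member
  of the refinement to be empty.
\<close>

definition covering_dim_le :: "'a topology \<Rightarrow> int \<Rightarrow> bool" where
  "covering_dim_le X n \<longleftrightarrow> -1 \<le> n \<and>
     (\<forall>\<U>. finite \<U> \<and> (\<forall>U\<in>\<U>. openin X U) \<and> \<Union>\<U> = topspace X \<longrightarrow>
       (\<exists>\<V>. finite \<V> \<and> (\<forall>V\<in>\<V>. openin X V) \<and> \<Union>\<V> = topspace X \<and>
            (\<forall>V\<in>\<V>. \<exists>U\<in>\<U>. V \<subseteq> U) \<and>
            (\<forall>\<W>\<subseteq>\<V>. int (card \<W>) > n + 1 \<longrightarrow> \<Inter>\<W> = {})))"

definition has_covering_dim :: "'a topology \<Rightarrow> int \<Rightarrow> bool" where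
  "has_covering_dim X n \<longleftrightarrow> covering_dim_le X n \<and> \<not> covering_dim_le X (n - 1)"

text \<open>Zero-dimensional sets are nonempty.\<close>

definition zero_dimensional :: "'a::topological_space set \<Rightarrow> bool" where
  "zero_dimensional S \<longleftrightarrow> has_covering_dim (top_of_set S) 0"

text \<open>Orthogonal projection onto a nonempty affine subspace \<open>P\<close>.\<close>

definition orth_proj :: "'a::euclidean_space set \<Rightarrow> 'a \<Rightarrow> 'a" where
  "orth_proj P x = (THE y. y \<in> P \<and> (\<forall>z\<in>P. orthogonal (x - y) (z - y)))"

lemma orth_proj_eqI:
  fixes P :: "'a::euclidean_space set"
  assumes "y \<in> P" "\<And>z. z \<in> P \<Longrightarrow> orthogonal (x - y) (z - y)"
  shows "orth_proj P x = y"
  unfolding orth_proj_def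
proof (rule the_equality)
  fix y' assume y': "y' \<in> P \<and> (\<forall>z\<in>P. orthogonal (x - y') (z - y'))"
  have "(x - y) \<bullet> (y' - y) = 0" "(x - y') \<bullet> (y - y') = 0"
    using assms y' by (auto simp: orthogonal_def)
  then have "(y' - y) \<bullet> (y' - y) = 0"
    by (simp add: inner_diff_left inner_diff_right inner_commute)
  then show "y' = y" by simp
qed (use assms in auto)

lemma orth_proj_eq_closest_point:
  fixes P :: "'a::euclidean_space set"
  assumes "affine P" "P \<noteq> {}"
  shows "orth_proj P x = closest_point P x"
proof (rule orth_proj_eqI)
  let ?c = "closest_point P x"
  have cl: "closed P" and cv: "convex P"
    using assms(1) affine_closed affine_imp_convex by blast+
  show c: "?c \<in> P" using closest_point_in_set[OF cl assms(2)] .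
  fix z assume z: "z \<in> P"
  have "2 *\<^sub>R ?c + (- 1) *\<^sub>R z \<in> P"
    by (rule mem_affine[OF assms(1) c z]) simp
  then have "(x - ?c) \<bullet> ((2 *\<^sub>R ?c + (- 1) *\<^sub>R z) - ?c) \<le> 0"
    using closest_point_dot[OF cv cl] by blast
  moreover have "(2 *\<^sub>R ?c + (- 1) *\<^sub>R z) - ?c = - (z - ?c)"
    by (simp add: scaleR_2)
  ultimately have "(x - ?c) \<bullet> (z - ?c) \<ge> 0" by (metis inner_minus_right neg_le_0_iff_le)
  moreover have "(x - ?c) \<bullet> (z - ?c) \<le> 0" using closest_point_dot[OF cv cl z] .
  ultimately show "orthogonal (x - ?c) (z - ?c)" by (simp add: orthogonal_def)
qed

definition tame :: "'a::euclidean_space set \<Rightarrow> bool" where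
  "tame K \<longleftrightarrow>
     (\<exists>(h :: 'a \<Rightarrow> 'a) g L. homeomorphism UNIV UNIV h g \<and> affine L \<and> aff_dim L = 1 \<and> h ` K \<subseteq> L)"

end

theory Submission
  imports Defs "HOL-Complex_Analysis.Complex_Analysis"
begin

text \<open>
  A cell is an open set homeomorphic to the whole space. If a compact set \<open>X\<close> has, for every
  \<open>\<epsilon> > 0\<close>, a finite cover by disjoint cells of diameter below \<open>\<epsilon>\<close>, then \<open>X\<close> is tame: inside its
  cell each piece of \<open>X\<close> can be shrunk towards a point, and these points can be moved onto a line
  inside the balls of the previous stage, so the resulting homeomorphisms and their inverses
  converge uniformly.

  Such covers exist as soon as, for some splitting of the space with one factor of dimension at
  most two, \<open>X\<close> is covered by small disjoint products \<open>M \<times> V\<close> with \<open>V\<close> a cell in that factor. Indeed,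
  shrinking every \<open>V\<close> towards a point of its own leaves pieces inside disjoint ellipsoids, however
  the sets \<open>M\<close> are linked with each other. Zero-dimensional compact sets in the line or the plane
  have fine covers by cells: intervals, or small domains with their holes filled, which are discs
  by the Riemann mapping theorem. So the products exist whenever one of the two
  projections of \<open>X\<close> is zero-dimensional.
\<close>

section \<open>Fine covers\<close>

text \<open>Two obstacles shape the argument: the image of \<open>X\<close> under the complementary
  projection may have positive dimension, and a small open set in a factor of dimension three or
  more need not be a cell. So the cells around \<open>X\<close> cannot be sought as products. The
  first obstacle is met fibrewise. On a fibre of the zero-dimensional projection the other
  projection is injective, so it embeds a compact part of \<open>X\<close>, and compactness spreads
  the cover of one fibre to the nearby ones. The second is met by moving points only in the factor
  of dimension one or two. Its cells give room to push every piece of \<open>X\<close> into a thin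
  slab; thin slabs around distinct points are disjoint and may be widened to cells in the other
  directions. The cells for \<open>X\<close> are the preimages of these under one homeomorphism with
  small displacement. For a plane of dimension 1 or 2 that factor is the direction of the plane, and
  the projection itself supplies the cells; for codimension 1 or 2 it is the orthogonal direction,
  and the fibres supply them.\<close>

definition small :: "real \<Rightarrow> 'a::metric_space set \<Rightarrow> bool" where
  "small e V \<longleftrightarrow> (\<forall>x\<in>V. \<forall>y\<in>V. dist x y < e)"

text \<open>For compact \<open>K\<close> and trivial \<open>Q\<close> this is covering dimension at
  most 0. The members are open in the ambient space, so that \<open>Q\<close> can constrain their
  shape, and they need not meet \<open>K\<close>.\<close>

definition fine_cover :: "('a::metric_space set \<Rightarrow> bool) \<Rightarrow> 'a set \<Rightarrow> bool" where
  "fine_cover Q K \<longleftrightarrow> (\<forall>e>0. \<exists>\<V>. finite \<V> \<and> disjoint \<V> \<and>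
     (\<forall>V\<in>\<V>. open V \<and> small e V \<and> Q V) \<and> K \<subseteq> \<Union>\<V>)"

definition cell :: "'a::euclidean_space set \<Rightarrow> bool" where
  "cell V \<longleftrightarrow> V homeomorphic (UNIV :: 'a set)"

lemma small_subset: "small e V \<Longrightarrow> W \<subseteq> V \<Longrightarrow> small e W"
  by (auto simp: small_def)

lemma small_mono: "small d V \<Longrightarrow> d \<le> e \<Longrightarrow> small e V"
  by (force simp: small_def)

lemma fine_coverE:
  assumes "fine_cover Q K" "e > 0"
  obtains \<V> where "finite \<V>" "disjoint \<V>" "\<And>V. V \<in> \<V> \<Longrightarrow> open V"
    "\<And>V. V \<in> \<V> \<Longrightarrow> small e V" "\<And>V. V \<in> \<V> \<Longrightarrow> Q V" "K \<subseteq> \<Union>\<V>"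
  using assms unfolding fine_cover_def by metis

lemma fine_cover_subset: "fine_cover Q K \<Longrightarrow> L \<subseteq> K \<Longrightarrow> fine_cover Q L"
  unfolding fine_cover_def by (meson order_trans)

lemma cell_nonempty: "cell V \<Longrightarrow> V \<noteq> {}"
  unfolding cell_def by (metis UNIV_not_empty homeomorphic_empty(2) homeomorphic_sym)

lemma uniform_positive_bound:
  fixes P :: "'i \<Rightarrow> real \<Rightarrow> bool"
  assumes "finite A" "\<And>a. a \<in> A \<Longrightarrow> \<exists>d>0. P a d"
    and mono: "\<And>a d d'. P a d \<Longrightarrow> 0 < d' \<Longrightarrow> d' \<le> d \<Longrightarrow> P a d'"
  shows "\<exists>d>0. \<forall>a\<in>A. P a d"
  using assms(1,2)
proof (induction A rule: finite_induct)
  case empty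
  show ?case using zero_less_one by blast
next
  case (insert a A)
  then obtain d1 d2 where "d1 > 0" "P a d1" "d2 > 0" "\<forall>a\<in>A. P a d2" by blast
  then show ?case by (intro exI[of _ "min d1 d2"]) (auto intro: mono)
qed

lemma uniform_positive_bound_pairs:
  fixes P :: "'i \<Rightarrow> 'i \<Rightarrow> real \<Rightarrow> bool"
  assumes "finite A" "\<And>a b. a \<in> A \<Longrightarrow> b \<in> A \<Longrightarrow> a \<noteq> b \<Longrightarrow> \<exists>d>0. P a b d"
    and mono: "\<And>a b d d'. P a b d \<Longrightarrow> 0 < d' \<Longrightarrow> d' \<le> d \<Longrightarrow> P a b d'"
  shows "\<exists>d>0. \<forall>a\<in>A. \<forall>b\<in>A. a \<noteq> b \<longrightarrow> P a b d"
proof (rule uniform_positive_bound[OF assms(1)])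
  show "\<exists>d>0. \<forall>b\<in>A. a \<noteq> b \<longrightarrow> P a b d" if "a \<in> A" for a
  proof (rule uniform_positive_bound[OF assms(1)])
    show "\<exists>d>0. a \<noteq> b \<longrightarrow> P a b d" if "b \<in> A" for b
      using assms(2)[OF \<open>a \<in> A\<close> that] zero_less_one by (cases "a = b") blast+
  qed (auto intro: mono)
qed (auto intro: mono)

text \<open>Disjointness turns the trace of one member into \<open>K\<close> minus the union of the
  others, hence into a closed part of \<open>K\<close>.\<close>

lemma compact_Int_disjoint_cover:
  fixes K :: "'a::t2_space set"
  assumes "compact K" "disjoint \<V>" "\<And>V. V \<in> \<V> \<Longrightarrow> open V" "K \<subseteq> \<Union>\<V>" "V \<in> \<V>"
  shows "compact (K \<inter> V)"
proof -
  have "K \<inter> V = K - \<Union>(\<V> - {V})"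
    using assms(2,4,5) by (auto simp: disjoint_def)
  then show ?thesis using assms(1,3) by (auto intro!: compact_diff)
qed

text \<open>Finitely many disjoint compact sets have a common positive distance \<open>r\<close>.
  Thickening by at most half of it keeps them apart, and the gap \<open>e - d\<close> pays for the
  growth in size.\<close>

lemma separate_disjoint_compacts:
  fixes \<C> :: "'a::heine_borel set set"
  assumes fin: "finite \<C>" and disj: "disjoint \<C>"
    and cpt: "\<And>C. C \<in> \<C> \<Longrightarrow> compact C" and sm: "\<And>C. C \<in> \<C> \<Longrightarrow> small d C" and "d < e"
  obtains f where "\<And>C. C \<in> \<C> \<Longrightarrow> open (f C)" "\<And>C. C \<in> \<C> \<Longrightarrow> C \<subseteq> f C"
    "\<And>C. C \<in> \<C> \<Longrightarrow> small e (f C)" "\<And>C D. C \<in> \<C> \<Longrightarrow> D \<in> \<C> \<Longrightarrow> C \<noteq> D \<Longrightarrow> f C \<inter> f D = {}"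
proof -
  have "\<exists>r>0. \<forall>(C, D) \<in> {(C, D). C \<in> \<C> \<and> D \<in> \<C> \<and> C \<noteq> D}. \<forall>x\<in>C. \<forall>y\<in>D. r \<le> dist x y"
    (is "\<exists>r>0. \<forall>p\<in>?A. ?P p r")
  proof (rule uniform_positive_bound)
    show "finite ?A"
      by (rule finite_subset[of _ "\<C> \<times> \<C>"]) (use fin in auto)
    show "\<exists>r>0. ?P p r" if pA: "p \<in> ?A" for p
    proof -
      obtain C D where p: "p = (C, D)" "C \<in> \<C>" "D \<in> \<C>" "C \<noteq> D" using pA by blast
      then have "C \<inter> D = {}" using disj by (auto simp: disjoint_def)
      then show ?thesis
        using separate_compact_closed[of C D] cpt compact_imp_closed p by auto
    qed
  qed fastforce
  then obtain r where r: "r > 0" "\<And>C D x y. C \<in> \<C> \<Longrightarrow> D \<in> \<C> \<Longrightarrow> C \<noteq> D \<Longrightarrow> x \<in> C \<Longrightarrow> y \<in> D \<Longrightarrow> r \<le> dist x y"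
    by fastforce
  define s where "s = min (r / 2) ((e - d) / 2)"
  have s: "s > 0" "2 * s \<le> r" "2 * s \<le> e - d" using r \<open>d < e\<close> by (auto simp: s_def min_def)
  define f where "f C = (\<Union>x\<in>C. ball x s)" for C :: "'a set"
  have tri: "dist x' y' \<ge> dist x y - 2 * s \<and> dist x' y' < dist x y + 2 * s"
    if "dist x x' < s" "dist y y' < s" for x x' y y' :: 'a
    using that dist_triangle[of x y x'] dist_triangle[of x' y y'] dist_triangle[of x' y' x] dist_triangle[of x y' y]
    by (simp add: dist_commute)
  show ?thesis
  proof
    show "small e (f C)" if "C \<in> \<C>" for C
      unfolding small_def
    proof clarify
      fix x' y' assume "x' \<in> f C" "y' \<in> f C"
      then obtain x y where "x \<in> C" "y \<in> C" "dist x x' < s" "dist y y' < s" by (auto simp: f_def)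
      moreover from this have "dist x y < d" using sm that by (auto simp: small_def)
      ultimately show "dist x' y' < e" using tri s by smt
    qed
    show "f C \<inter> f D = {}" if "C \<in> \<C>" "D \<in> \<C>" "C \<noteq> D" for C D
    proof (rule ccontr)
      assume "f C \<inter> f D \<noteq> {}"
      then obtain z x y where "x \<in> C" "y \<in> D" "dist x z < s" "dist y z < s" by (auto simp: f_def)
      then show False using r(2)[OF that, of x y] s dist_triangle2[of x y z] by auto
    qed
  qed (use s in \<open>auto simp: f_def\<close>)
qed

text \<open>Compact pieces suffice: taken of size \<open>e/2\<close>, they can be thickened to open
  sets that stay below \<open>e\<close>.\<close>

lemma fine_coverI_compacts:
  fixes K :: "'a::heine_borel set"
  assumes "\<And>e. e > 0 \<Longrightarrow> \<exists>\<C>. finite \<C> \<and> disjoint \<C> \<and> (\<forall>C\<in>\<C>. compact C \<and> small e C) \<and> K \<subseteq> \<Union>\<C>"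
  shows "fine_cover (\<lambda>_. True) K"
  unfolding fine_cover_def
proof (intro allI impI)
  fix e :: real assume "e > 0"
  then obtain \<C> where \<C>: "finite \<C>" "disjoint \<C>" "\<And>C. C \<in> \<C> \<Longrightarrow> compact C" "\<And>C. C \<in> \<C> \<Longrightarrow> small (e/2) C" "K \<subseteq> \<Union>\<C>"
    using assms[of "e/2"] by auto
  have "e / 2 < e" using \<open>e > 0\<close> by simp
  then obtain f where f: "\<And>C. C \<in> \<C> \<Longrightarrow> open (f C)" "\<And>C. C \<in> \<C> \<Longrightarrow> C \<subseteq> f C"
    "\<And>C. C \<in> \<C> \<Longrightarrow> small e (f C)" "\<And>C D. C \<in> \<C> \<Longrightarrow> D \<in> \<C> \<Longrightarrow> C \<noteq> D \<Longrightarrow> f C \<inter> f D = {}"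
    using separate_disjoint_compacts[OF \<C>(1-4), of e] by metis
  have "disjoint (f ` \<C>)" using f(4) unfolding disjoint_def by blast
  moreover have "K \<subseteq> \<Union>(f ` \<C>)" using f(2) \<C>(5) by blast
  ultimately show "\<exists>\<V>. finite \<V> \<and> disjoint \<V> \<and> (\<forall>V\<in>\<V>. open V \<and> small e V \<and> True) \<and> K \<subseteq> \<Union>\<V>"
    using f \<C> by (intro exI[of _ "f ` \<C>"]) auto
qed

text \<open>In dimension 0 any two distinct members of the refinement are disjoint, so each member
  is clopen in \<open>K\<close> and therefore compact.\<close>

lemma zero_dimensional_imp_fine_cover:
  fixes K :: "'a::heine_borel set"
  assumes "compact K" "zero_dimensional K"
  shows "fine_cover (\<lambda>_. True) K"
proof (rule fine_coverI_compacts)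
  fix e :: real assume e: "e > 0"
  obtain T where T: "finite T" "K \<subseteq> (\<Union>x\<in>T. ball x (e/2))"
    using compactE_image[OF \<open>compact K\<close>, of K "\<lambda>x. ball x (e/2)"] e
    by (metis UN_I centre_in_ball half_gt_zero open_ball subsetI)
  have dim: "covering_dim_le (top_of_set K) 0"
    using assms(2) by (simp add: zero_dimensional_def has_covering_dim_def)
  define \<U> where "\<U> = (\<lambda>x. K \<inter> ball x (e/2)) ` T"
  have "finite \<U>" "\<forall>U\<in>\<U>. openin (top_of_set K) U" "\<Union>\<U> = topspace (top_of_set K)"
    using T by (auto simp: \<U>_def openin_open_Int)
  then obtain \<V> where \<V>: "finite \<V>" "\<forall>V\<in>\<V>. openin (top_of_set K) V" "\<Union>\<V> = K"
      "\<forall>V\<in>\<V>. \<exists>U\<in>\<U>. V \<subseteq> U" "\<forall>\<W>\<subseteq>\<V>. int (card \<W>) > 1 \<longrightarrow> \<Inter>\<W> = {}"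
    using dim[unfolded covering_dim_le_def, THEN conjunct2, rule_format, of \<U>] by fastforce
  have disj: "V \<inter> W = {}" if "V \<in> \<V>" "W \<in> \<V>" "V \<noteq> W" for V W
    using \<V>(5)[rule_format, of "{V, W}"] that by auto
  have "compact V \<and> small e V" if V: "V \<in> \<V>" for V
  proof
    have "V = K - \<Union>(\<V> - {V})" using \<V>(3) disj V by blast
    moreover have "openin (top_of_set K) (\<Union>(\<V> - {V}))" using \<V>(2) by blast
    ultimately have "closedin (top_of_set K) V" by (metis closedin_diff closedin_topspace topspace_euclidean_subtopology)
    then show "compact V" using closedin_compact \<open>compact K\<close> by blast
    obtain x where "V \<subseteq> ball x (e/2)" using \<V>(4) V unfolding \<U>_def by blast
    then show "small e V" by (force simp: small_def intro: dist_triangle_half_r)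
  qed
  then show "\<exists>\<C>. finite \<C> \<and> disjoint \<C> \<and> (\<forall>C\<in>\<C>. compact C \<and> small e C) \<and> K \<subseteq> \<Union>\<C>"
    using \<V> disj by (intro exI[of _ \<V>]) (auto simp: disjoint_def)
qed

text \<open>Injectivity keeps the images of disjoint pieces apart, uniform continuity keeps them
  small. A continuous map that is not injective can send a Cantor set onto a cube.\<close>

lemma fine_cover_inj_image:
  fixes f :: "'a::metric_space \<Rightarrow> 'b::heine_borel"
  assumes "compact K" "fine_cover (\<lambda>_. True) K" "continuous_on K f" "inj_on f K"
  shows "fine_cover (\<lambda>_. True) (f ` K)"
proof (rule fine_coverI_compacts)
  fix e :: real assume e: "e > 0"
  obtain d where d: "d > 0" "\<And>x y. x \<in> K \<Longrightarrow> y \<in> K \<Longrightarrow> dist x y < d \<Longrightarrow> dist (f x) (f y) < e"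
    using compact_uniformly_continuous[OF assms(3,1)] e unfolding uniformly_continuous_on_def by metis
  obtain \<V> where \<V>: "finite \<V>" "disjoint \<V>" "\<And>V. V \<in> \<V> \<Longrightarrow> open V"
    "\<And>V. V \<in> \<V> \<Longrightarrow> small d V" "K \<subseteq> \<Union>\<V>"
    using fine_coverE[OF assms(2) d(1)] by metis
  have "compact (f ` (K \<inter> V)) \<and> small e (f ` (K \<inter> V))" if "V \<in> \<V>" for V
  proof
    show "compact (f ` (K \<inter> V))"
      using compact_Int_disjoint_cover[OF assms(1) \<V>(2,3,5) that]
      by (meson compact_continuous_image continuous_on_subset assms(3) inf_le1)
    show "small e (f ` (K \<inter> V))" using d(2) \<V>(4)[OF that] by (auto simp: small_def)
  qed
  moreover have "disjoint ((\<lambda>V. f ` (K \<inter> V)) ` \<V>)"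
    unfolding disjoint_def
  proof clarify
    fix V W assume "V \<in> \<V>" "W \<in> \<V>" "f ` (K \<inter> V) \<noteq> f ` (K \<inter> W)"
    then have "V \<inter> W = {}" using \<V>(2) by (auto simp: disjoint_def)
    then show "f ` (K \<inter> V) \<inter> f ` (K \<inter> W) = {}" using assms(4) by (auto simp: inj_on_def)
  qed
  ultimately show "\<exists>\<C>. finite \<C> \<and> disjoint \<C> \<and> (\<forall>C\<in>\<C>. compact C \<and> small e C) \<and> f ` K \<subseteq> \<Union>\<C>"
    using \<V>(1,5) by (intro exI[of _ "(\<lambda>V. f ` (K \<inter> V)) ` \<V>"]) blast
qed

text \<open>Components of open sets are open here, so compactness selects finitely many of them.
  Connectedness is what yields intervals in the line and makes hole filling work in the
  plane.\<close>

lemma fine_cover_connected: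
  fixes K :: "'a::real_normed_vector set"
  assumes "compact K" "fine_cover (\<lambda>_. True) K"
  shows "fine_cover (\<lambda>W. connected W \<and> W \<noteq> {}) K"
  unfolding fine_cover_def
proof (intro allI impI)
  fix e :: real assume e: "e > 0"
  obtain \<V> where \<V>: "finite \<V>" "disjoint \<V>" "\<And>V. V \<in> \<V> \<Longrightarrow> open V"
    "\<And>V. V \<in> \<V> \<Longrightarrow> small e V" "K \<subseteq> \<Union>\<V>"
    using fine_coverE[OF assms(2) e] by metis
  define \<W> where "\<W> = (\<Union>V\<in>\<V>. components V)"
  have op: "open W" if "W \<in> \<W>" for W
    using that \<V>(3) open_components by (auto simp: \<W>_def)
  have "\<Union>\<W> = (\<Union>V\<in>\<V>. \<Union>(components V))" unfolding \<W>_def by blast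
  then have "K \<subseteq> \<Union>\<W>" using \<V>(5) by simp
  then obtain \<W>' where \<W>': "\<W>' \<subseteq> \<W>" "finite \<W>'" "K \<subseteq> \<Union>\<W>'"
    using compactE[OF assms(1), of \<W>] op by metis
  have "disjoint \<W>"
    unfolding disjoint_def
  proof (intro ballI impI)
    fix W W' assume "W \<in> \<W>" "W' \<in> \<W>" and ne: "W \<noteq> W'"
    then obtain V V' where V: "V \<in> \<V>" "V' \<in> \<V>" "W \<in> components V" "W' \<in> components V'" by (auto simp: \<W>_def)
    show "W \<inter> W' = {}"
    proof (cases "V = V'")
      case True
      then show ?thesis using V ne components_nonoverlap by blast
    next
      case False
      then have "V \<inter> V' = {}" using \<V>(2) V by (auto simp: disjoint_def)
      then show ?thesis using in_components_subset[OF V(3)] in_components_subset[OF V(4)] by blast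
    qed
  qed
  then have "disjoint \<W>'" using \<W>'(1) by (auto simp: disjoint_def)
  moreover have "open W \<and> small e W \<and> connected W \<and> W \<noteq> {}" if W: "W \<in> \<W>'" for W
  proof -
    obtain V where V: "V \<in> \<V>" "W \<in> components V" using W \<W>'(1) unfolding \<W>_def by blast
    moreover have "open W" using op that \<W>'(1) by blast
    moreover have "small e W" using small_subset[OF \<V>(4)[OF V(1)] in_components_subset[OF V(2)]] .
    ultimately show ?thesis using in_components_connected in_components_nonempty by blast
  qed
  ultimately show "\<exists>\<V>. finite \<V> \<and> disjoint \<V> \<and> (\<forall>V\<in>\<V>. open V \<and> small e V \<and> connected V \<and> V \<noteq> {}) \<and> K \<subseteq> \<Union>\<V>"
    using \<W>' by (intro exI[of _ \<W>']) auto
qed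

section \<open>Covers by cells in the line and in the plane\<close>

lemma small_bounded: "small e V \<Longrightarrow> bounded V"
  unfolding small_def bounded_def by (meson less_imp_le)

lemma cell_ball: "r > 0 \<Longrightarrow> cell (ball (a::'a::euclidean_space) r)"
  unfolding cell_def by (simp add: homeomorphic_ball_UNIV)

lemma fine_cover_cell_real:
  fixes K :: "real set"
  assumes "compact K" "fine_cover (\<lambda>_. True) K"
  shows "fine_cover cell K"
  unfolding fine_cover_def
proof (intro allI impI)
  fix e :: real assume e: "e > 0"
  obtain \<V> where \<V>: "finite \<V>" "disjoint \<V>" "\<And>V. V \<in> \<V> \<Longrightarrow> open V"
    "\<And>V. V \<in> \<V> \<Longrightarrow> small e V" "\<And>V. V \<in> \<V> \<Longrightarrow> connected V \<and> V \<noteq> {}" "K \<subseteq> \<Union>\<V>"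
    using fine_coverE[OF fine_cover_connected[OF assms] e] by metis
  have "cell V" if "V \<in> \<V>" for V
  proof -
    have V: "open V" "connected V" "V \<noteq> {}" "bounded V"
      using \<V>(3-5)[OF that] small_bounded by auto
    have "V = {Inf V<..<Sup V}"
    proof
      show "V \<subseteq> {Inf V<..<Sup V}"
      proof
        fix x assume x: "x \<in> V"
        then obtain d where d: "d > 0" "cball x d \<subseteq> V" using V(1) open_contains_cball by blast
        then have "x - d \<in> V" "x + d \<in> V" by (auto simp: dist_real_def subset_iff)
        then show "x \<in> {Inf V<..<Sup V}"
          using cInf_lower[of "x - d" V] cSup_upper[of "x + d" V] bounded_imp_bdd_below[OF V(4)]
            bounded_imp_bdd_above[OF V(4)] d(1) by auto
      qed
      show "{Inf V<..<Sup V} \<subseteq> V"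
      proof
        fix x assume x: "x \<in> {Inf V<..<Sup V}"
        obtain a where "a \<in> V" "a < x" using cInf_lessD[OF V(3)] x by auto
        moreover obtain b where "b \<in> V" "x < b" using less_cSupD[OF V(3)] x by auto
        ultimately show "x \<in> V" using connectedD_interval[OF V(2)] by (meson less_imp_le)
      qed
    qed
    then have "V = ball ((Inf V + Sup V)/2) ((Sup V - Inf V)/2)"
      by (simp add: greaterThanLessThan_eq_ball)
    moreover have "Inf V < Sup V" using \<open>V = {Inf V<..<Sup V}\<close> V(3) by force
    ultimately show ?thesis using cell_ball[of "(Sup V - Inf V)/2" "(Inf V + Sup V)/2"] by simp
  qed
  then show "\<exists>\<V>. finite \<V> \<and> disjoint \<V> \<and> (\<forall>V\<in>\<V>. open V \<and> small e V \<and> cell V) \<and> K \<subseteq> \<Union>\<V>"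
    using \<V> by blast
qed

text \<open>\<open>W\<close> together with the bounded components of its complement. In this form
  the set left over, \<open>outside W\<close>, is connected whenever \<open>W\<close> is
  bounded.\<close>

definition fill :: "complex set \<Rightarrow> complex set" where
  "fill W = - outside W"

lemma subset_fill: "W \<subseteq> fill W"
  using outside_no_overlap[of W] unfolding fill_def by blast

lemma fill_subset_ball: "W \<subseteq> ball x e \<Longrightarrow> fill W \<subseteq> ball x e"
  using outside_subset_convex[OF convex_ball, of W x e] by (auto simp: fill_def)

text \<open>The complement of \<open>fill W\<close> is connected and unbounded, so
  \<open>fill W\<close> has empty inside and is simply connected; the Riemann mapping theorem then
  gives a disc.\<close>

lemma cell_fill:
  assumes "open W" "connected W" "W \<noteq> {}" "bounded W"
  shows "open (fill W)" "connected (fill W)" "cell (fill W)"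
proof -
  have dim: "2 \<le> DIM(complex)" by simp
  have out: "connected (outside W)" "outside W \<noteq> {}" "\<not> bounded (outside W)"
    using connected_outside[OF assms(4) dim] outside_bounded_nonempty unbounded_outside assms(4) by auto
  then have comp: "outside W \<in> components (- W)" by (simp add: outside_in_components)
  then show op: "open (fill W)"
    unfolding fill_def using closed_components[OF _ comp] assms(1) by (simp add: closed_Compl open_Compl)
  \<comment> \<open>Removing from the whole plane a component of the complement of a connected set
    leaves a connected set.\<close>
  show con: "connected (fill W)"
    using component_diff_connected[of W UNIV "outside W"] comp assms(2)
    by (simp add: fill_def Compl_eq_Diff_UNIV connected_UNIV)
  have "inside (fill W) = {}"
    by (rule inside_complement_unbounded_connected_empty) (use out in \<open>simp_all add: fill_def\<close>)
  then have "simply_connected (fill W)"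
    using simply_connected_eq_empty_inside[OF op] con by simp
  then have "fill W homeomorphic ball (0::complex) 1"
    using simply_connected_eq_homeomorphic_to_disc[OF op] subset_fill assms(3) by blast
  then show "cell (fill W)"
    unfolding cell_def using homeomorphic_ball01_UNIV homeomorphic_trans by blast
qed

text \<open>If \<open>W'\<close> meets a hole of \<open>W\<close>, it cannot leave the holes of
  \<open>W\<close> without crossing \<open>W\<close>; then \<open>outside W\<close> is a connected
  unbounded set off \<open>W'\<close>, so it lies in \<open>outside W'\<close>, and the fills are
  nested. If neither set meets a hole of the other, then \<open>fill W\<close> is connected, avoids
  \<open>W'\<close> and starts outside it, so it never enters a hole of \<open>W'\<close>.\<close>

lemma fill_laminar:
  assumes "open W" "connected W" "W \<noteq> {}" "bounded W" "open W'" "connected W'" "W' \<noteq> {}" "bounded W'"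
    and "W \<inter> W' = {}"
  shows "fill W \<subseteq> fill W' \<or> fill W' \<subseteq> fill W \<or> fill W \<inter> fill W' = {}"
proof -
  have nest: "fill B \<subseteq> fill A"
    if "connected B" "bounded A" "bounded B" "A \<inter> B = {}" "inside A \<inter> B \<noteq> {}" for A B :: "complex set"
  proof -
    have "outside A \<inter> B = {}"
      using inside_outside_intersect_connected[of B A] that by blast
    then have "outside A \<subseteq> - B" by blast
    moreover have "connected (outside A)" "\<not> bounded (outside A)"
      using connected_outside[of A] unbounded_outside[of A] that(2) by simp_all
    ultimately have "outside A \<subseteq> outside B"
      by (smt (verit) bounded_subset connected_component_maximal mem_Collect_eq outside subsetI)
    then show ?thesis by (auto simp: fill_def)
  qed
  show ?thesis
  proof (cases "inside W \<inter> W' = {} \<and> inside W' \<inter> W = {}")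
    case False
    then show ?thesis using nest[of W' W] nest[of W W'] assms by blast
  next
    case True
    have "W' \<inter> fill W = {}" using True assms(9) union_with_inside[of W] by (auto simp: fill_def)
    moreover have "W \<subseteq> outside W'" using True assms(9) inside_Un_outside[of W'] by blast
    moreover have "connected (fill W)" using cell_fill assms by blast
    ultimately have "fill W \<inter> inside W' = {}"
      using inside_outside_intersect_connected[of "fill W" W'] subset_fill[of W] assms(3) by blast
    then have "fill W \<inter> fill W' = {}"
      using \<open>W' \<inter> fill W = {}\<close> union_with_inside[of W'] by (auto simp: fill_def)
    then show ?thesis by blast
  qed
qed

text \<open>Fills may be nested, but by laminarity the maximal ones are disjoint, and they still
  cover. Filling stays inside any ball around \<open>W\<close>; the size \<open>e/2\<close> at the
  start makes that ball small enough.\<close>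

lemma fine_cover_cell_complex:
  fixes K :: "complex set"
  assumes "compact K" "fine_cover (\<lambda>_. True) K"
  shows "fine_cover cell K"
  unfolding fine_cover_def
proof (intro allI impI)
  fix e :: real assume e: "e > 0"
  obtain \<V> where \<V>: "finite \<V>" "disjoint \<V>" "\<And>V. V \<in> \<V> \<Longrightarrow> open V"
    "\<And>V. V \<in> \<V> \<Longrightarrow> small (e/2) V" "\<And>V. V \<in> \<V> \<Longrightarrow> connected V \<and> V \<noteq> {}" "K \<subseteq> \<Union>\<V>"
    using fine_coverE[OF fine_cover_connected[OF assms], of "e/2"] e by (metis half_gt_zero)
  note bd = small_bounded[OF \<V>(4)]
  define \<F> where "\<F> = fill ` \<V>"
  define \<G> where "\<G> = {F\<in>\<F>. \<forall>G\<in>\<F>. F \<subseteq> G \<longrightarrow> F = G}"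
  have fin: "finite \<F>" using \<V>(1) by (simp add: \<F>_def)
  have "K \<subseteq> \<Union>\<G>"
  proof
    fix x assume "x \<in> K"
    then obtain V where "V \<in> \<V>" "x \<in> fill V" using \<V>(6) subset_fill by blast
    then obtain G where "G \<in> \<F>" "fill V \<subseteq> G" "\<forall>b\<in>\<F>. G \<subseteq> b \<longrightarrow> G = b"
      using finite_has_maximal2[OF fin, of "fill V"] by (auto simp: \<F>_def)
    then show "x \<in> \<Union>\<G>" using \<open>x \<in> fill V\<close> by (auto simp: \<G>_def)
  qed
  moreover have "disjoint \<G>"
    unfolding disjoint_def
  proof (intro ballI impI)
    fix F G assume FG: "F \<in> \<G>" "G \<in> \<G>" "F \<noteq> G"
    then obtain V W where VW: "V \<in> \<V>" "W \<in> \<V>" "F = fill V" "G = fill W" by (auto simp: \<G>_def \<F>_def)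
    then have "V \<noteq> W" using FG(3) by blast
    then have "V \<inter> W = {}" using \<V>(2) VW(1,2) unfolding disjoint_def by blast
    then have "F \<subseteq> G \<or> G \<subseteq> F \<or> F \<inter> G = {}"
      using fill_laminar[of V W] VW \<V>(3,5) bd by blast
    moreover have "\<not> F \<subseteq> G" "\<not> G \<subseteq> F" using FG by (auto simp: \<G>_def)
    ultimately show "F \<inter> G = {}" by blast
  qed
  moreover have "open F \<and> small e F \<and> cell F" if F: "F \<in> \<G>" for F
  proof -
    obtain V where V: "V \<in> \<V>" "F = fill V" using F by (auto simp: \<G>_def \<F>_def)
    obtain x where "x \<in> V" using \<V>(5) V(1) by blast
    then have "V \<subseteq> ball x (e/2)" using \<V>(4)[OF V(1)] by (auto simp: small_def)
    then have "F \<subseteq> ball x (e/2)" using fill_subset_ball V(2) by blast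
    then have "small e F" by (force simp: small_def intro: dist_triangle_half_r)
    then show ?thesis using cell_fill[of V] V \<V>(3,5) bd by blast
  qed
  ultimately show "\<exists>\<V>. finite \<V> \<and> disjoint \<V> \<and> (\<forall>V\<in>\<V>. open V \<and> small e V \<and> cell V) \<and> K \<subseteq> \<Union>\<V>"
    using fin by (intro exI[of _ \<G>]) (auto simp: \<G>_def)
qed

text \<open>A tube lemma argument. The cover chosen for the fibre over \<open>y\<close> works over a
  whole neighbourhood of \<open>y\<close>, so a base cover of mesh below a Lebesgue number can
  assign one such fibre cover to each of its members. Products over different members of the base
  are disjoint in the first factor, products over the same member in the second.\<close>

lemma product_cover:
  fixes \<alpha> :: "'a::metric_space \<Rightarrow> 'c::heine_borel" and \<beta> :: "'a \<Rightarrow> 'd::metric_space"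
  assumes X: "compact X" "continuous_on X \<alpha>" "continuous_on X \<beta>" and "e > 0"
    and base: "fine_cover Q (\<alpha> ` X)"
    and fibre: "\<And>y. y \<in> \<alpha> ` X \<Longrightarrow> fine_cover R (\<beta> ` {x \<in> X. \<alpha> x = y})"
  obtains I where "finite I"
    "\<And>A B. (A, B) \<in> I \<Longrightarrow> open A \<and> small e A \<and> Q A \<and> open B \<and> small e B \<and> R B"
    "\<And>A B A' B'. (A, B) \<in> I \<Longrightarrow> (A', B') \<in> I \<Longrightarrow> (A, B) \<noteq> (A', B') \<Longrightarrow> A \<inter> A' = {} \<or> B \<inter> B' = {}"
    "\<And>x. x \<in> X \<Longrightarrow> \<exists>(A, B)\<in>I. \<alpha> x \<in> A \<and> \<beta> x \<in> B"
proof -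
  define P where "P y \<B> \<longleftrightarrow> finite \<B> \<and> disjoint \<B> \<and> (\<forall>B\<in>\<B>. open B \<and> small e B \<and> R B) \<and>
      \<beta> ` {x \<in> X. \<alpha> x = y} \<subseteq> \<Union>\<B>" for y \<B>
  have "\<forall>y\<in>\<alpha> ` X. \<exists>\<B>. P y \<B>"
    using fibre \<open>e > 0\<close> unfolding P_def fine_cover_def by blast
  then obtain \<B> where P: "\<And>y. y \<in> \<alpha> ` X \<Longrightarrow> P y (\<B> y)" by (metis bchoice)
  note \<B> = P[unfolded P_def, THEN conjunct1] P[unfolded P_def, THEN conjunct2, THEN conjunct1]
    P[unfolded P_def, THEN conjunct2, THEN conjunct2, THEN conjunct1, rule_format]
    P[unfolded P_def, THEN conjunct2, THEN conjunct2, THEN conjunct2]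
  \<comment> \<open>The base points over which the cover chosen for \<open>y\<close> still works.
    The complement is the continuous image of a compact set, so \<open>U y\<close> is open.\<close>
  define U where "U y = - \<alpha> ` (X \<inter> \<beta> -` (- \<Union>(\<B> y)))" for y
  have "open (U y)" if "y \<in> \<alpha> ` X" for y
  proof -
    have "closed (- \<Union>(\<B> y))" using \<B>(3)[OF that] by (auto intro!: open_Union)
    then have "closedin (top_of_set X) (X \<inter> \<beta> -` (- \<Union>(\<B> y)))"
      using continuous_closedin_preimage[OF X(3)] by blast
    then have "compact (X \<inter> \<beta> -` (- \<Union>(\<B> y)))" using closedin_compact X(1) by blast
    then show ?thesis unfolding U_def
      by (meson X(2) compact_continuous_image compact_imp_closed continuous_on_subset inf_le1 open_Compl)
  qed
  then have opU: "open G" if "G \<in> U ` (\<alpha> ` X)" for G using that by blast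
  have U_self: "y \<in> U y" if "y \<in> \<alpha> ` X" for y using \<B>(4)[OF that] unfolding U_def by blast
  have cov: "\<alpha> ` X \<subseteq> \<Union>(U ` (\<alpha> ` X))"
  proof
    fix y assume "y \<in> \<alpha> ` X"
    then show "y \<in> \<Union>(U ` (\<alpha> ` X))" using U_self[of y] by (intro UnionI[of "U y"] imageI)
  qed
  have "compact (\<alpha> ` X)" using X compact_continuous_image by blast
  from Heine_Borel_lemma[OF this cov opU]
  obtain d where d: "d > 0" "\<And>y. y \<in> \<alpha> ` X \<Longrightarrow> \<exists>G\<in>U ` (\<alpha> ` X). ball y d \<subseteq> G"
    by metis
  obtain \<A> where \<A>: "finite \<A>" "disjoint \<A>" "\<And>A. A \<in> \<A> \<Longrightarrow> open A"
    "\<And>A. A \<in> \<A> \<Longrightarrow> small (min d e) A" "\<And>A. A \<in> \<A> \<Longrightarrow> Q A" "\<alpha> ` X \<subseteq> \<Union>\<A>"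
    using fine_coverE[OF base, of "min d e"] d(1) \<open>e > 0\<close> by (metis min_less_iff_conj)
  \<comment> \<open>The Lebesgue number only concerns balls about points of the base image, so
    members that miss this image are dropped.\<close>
  define \<A>' where "\<A>' = {A \<in> \<A>. A \<inter> \<alpha> ` X \<noteq> {}}"
  have "\<exists>y\<in>\<alpha> ` X. A \<subseteq> U y" if A: "A \<in> \<A>'" for A
  proof -
    obtain x where "x \<in> X" "\<alpha> x \<in> A" using A by (auto simp: \<A>'_def)
    moreover from this have "A \<subseteq> ball (\<alpha> x) d" using A \<A>(4) by (auto simp: \<A>'_def small_def)
    ultimately show ?thesis using d(2)[of "\<alpha> x"] by blast
  qed
  then obtain c where c: "\<And>A. A \<in> \<A>' \<Longrightarrow> c A \<in> \<alpha> ` X" "\<And>A. A \<in> \<A>' \<Longrightarrow> A \<subseteq> U (c A)" by metis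
  show ?thesis
  proof
    show "finite (Sigma \<A>' (\<lambda>A. \<B> (c A)))" using \<A>(1) \<B>(1) c(1) by (intro finite_SigmaI) (auto simp: \<A>'_def)
    show "open A \<and> small e A \<and> Q A \<and> open B \<and> small e B \<and> R B" if "(A, B) \<in> Sigma \<A>' (\<lambda>A. \<B> (c A))" for A B
      using that \<A>(3-5)[of A] \<B>(3)[OF c(1)] small_mono[of "min d e" A e] by (auto simp: \<A>'_def)
    show "A \<inter> A' = {} \<or> B \<inter> B' = {}"
      if "(A, B) \<in> Sigma \<A>' (\<lambda>A. \<B> (c A))" "(A', B') \<in> Sigma \<A>' (\<lambda>A. \<B> (c A))" "(A, B) \<noteq> (A', B')" for A B A' B'
      using that \<A>(2) \<B>(2)[OF c(1), of A] by (cases "A = A'") (auto simp: \<A>'_def disjoint_def)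
    show "\<exists>(A, B)\<in>Sigma \<A>' (\<lambda>A. \<B> (c A)). \<alpha> x \<in> A \<and> \<beta> x \<in> B" if x: "x \<in> X" for x
    proof -
      obtain A where A: "A \<in> \<A>'" "\<alpha> x \<in> A" using x \<A>(6) unfolding \<A>'_def by blast
      then have "\<alpha> x \<in> U (c A)" using c by blast
      then have "\<beta> x \<in> \<Union>(\<B> (c A))" using x by (auto simp: U_def)
      then show ?thesis using A by blast
    qed
  qed
qed

section \<open>Shrinking inside cells\<close>

lemma homeomorphism_support:
  assumes "homeomorphism UNIV UNIV h h'" "\<And>x. x \<notin> C \<Longrightarrow> h x = x"
  shows "h x \<in> C \<longleftrightarrow> x \<in> C"
  using assms by (metis UNIV_I homeomorphism_apply1)

text \<open>The maps are composed instead of being defined piecewise: every factor is already a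
  homeomorphism of the whole space, so nothing has to be checked at the boundaries of the
  \<open>C i\<close>, and on \<open>C i\<close> all other factors act as the identity.\<close>

lemma glue_homeomorphisms:
  fixes h :: "'i \<Rightarrow> 'a::topological_space \<Rightarrow> 'a"
  assumes "finite I" "\<And>i. i \<in> I \<Longrightarrow> homeomorphism UNIV UNIV (h i) (h' i)"
    "\<And>i x. i \<in> I \<Longrightarrow> x \<notin> C i \<Longrightarrow> h i x = x"
    "\<And>i j. i \<in> I \<Longrightarrow> j \<in> I \<Longrightarrow> i \<noteq> j \<Longrightarrow> C i \<inter> C j = {}"
  shows "\<exists>g g'. homeomorphism UNIV UNIV g g' \<and> (\<forall>i\<in>I. \<forall>x\<in>C i. g x = h i x) \<and> (\<forall>x. x \<notin> (\<Union>i\<in>I. C i) \<longrightarrow> g x = x)"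
  using assms
proof (induction I rule: finite_induct)
  case empty
  show ?case by (intro exI[of _ id]) (auto simp: homeomorphism_def)
next
  case (insert i I)
  have "\<exists>g g'. homeomorphism UNIV UNIV g g' \<and> (\<forall>i\<in>I. \<forall>x\<in>C i. g x = h i x) \<and>
      (\<forall>x. x \<notin> (\<Union>i\<in>I. C i) \<longrightarrow> g x = x)"
    by (rule insert.IH) (fact insert.prems(1)[OF insertI2] insert.prems(2)[OF insertI2] insert.prems(3)[OF insertI2 insertI2])+
  then obtain g g' where g: "homeomorphism UNIV UNIV g g'" "\<forall>i\<in>I. \<forall>x\<in>C i. g x = h i x"
     "\<forall>x. x \<notin> (\<Union>i\<in>I. C i) \<longrightarrow> g x = x"
    by blast
  have hi: "homeomorphism UNIV UNIV (h i) (h' i)" "\<And>x. x \<notin> C i \<Longrightarrow> h i x = x" using insert.prems by auto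
  have disj: "C i \<inter> C j = {}" if "j \<in> I" for j using insert.prems(3)[of i j] insert.hyps that by auto
  have "homeomorphism UNIV UNIV (g \<circ> h i) (h' i \<circ> g')"
    using homeomorphism_compose[OF hi(1) g(1)] .
  moreover have "(g \<circ> h i) x = h j x" if "j \<in> insert i I" "x \<in> C j" for j x
  proof (cases "j = i")
    case True
    then have "h i x \<in> C i" using homeomorphism_support[OF hi] that by blast
    then have "h i x \<notin> (\<Union>i\<in>I. C i)" using disj by auto
    then show ?thesis using g(3) True by simp
  next
    case False
    then have "x \<notin> C i" "j \<in> I" using that disj by auto
    then show ?thesis using hi(2) g(2) that by auto
  qed
  moreover have "(g \<circ> h i) x = x" if "x \<notin> (\<Union>i\<in>insert i I. C i)" for x
    using that g(3) hi(2) by auto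
  ultimately show ?case by blast
qed

text \<open>A greedy choice. The sets may overlap or even coincide, as the second factors of
  different products do, so disjointness cannot provide the distinct points.\<close>

lemma distinct_representatives:
  assumes "finite I" "\<And>i. i \<in> I \<Longrightarrow> infinite (A i)"
  shows "\<exists>p. inj_on p I \<and> (\<forall>i\<in>I. p i \<in> A i)"
  using assms
proof (induction I rule: finite_induct)
  case (insert i I)
  then obtain p where p: "inj_on p I" "\<forall>i\<in>I. p i \<in> A i" by auto
  obtain a where "a \<in> A i" "a \<notin> p ` I"
    using insert by (metis finite_imageI finite_subset insertI1 subsetI)
  then show ?case using p insert.hyps
    by (intro exI[of _ "p(i := a)"]) (auto simp: inj_on_def)
qed auto

text \<open>
  Radially, \<open>shrink k\<close> for \<open>0 < k \<le> 1\<close> is the piecewise linear map that scales \<open>[0, 1]\<close> by \<open>k\<close>, stretches \<open>[1, 2]\<close>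
  onto \<open>[k, 2]\<close> and is the identity beyond \<open>2\<close>; \<open>unshrink_radius\<close> is the radial inverse. The \<open>min\<close>/\<open>max\<close>
  formulas make joint continuity in \<open>k\<close> and the vector immediate.
\<close>

definition shrink_factor :: "real \<Rightarrow> real \<Rightarrow> real" where
  "shrink_factor k r = max k (min 1 ((2 - (2 - k) * (2 - r)) / max 1 r))"

definition unshrink_radius :: "real \<Rightarrow> real \<Rightarrow> real" where
  "unshrink_radius k u = max u (min (u / k) (2 - (2 - u) / (2 - k)))"

definition shrink :: "real \<Rightarrow> 'a::real_normed_vector \<Rightarrow> 'a" where
  "shrink k v = shrink_factor k (norm v) *\<^sub>R v"

definition unshrink :: "real \<Rightarrow> 'a::real_normed_vector \<Rightarrow> 'a" where
  "unshrink k w = w /\<^sub>R shrink_factor k (unshrink_radius k (norm w))"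

lemma shrink_factor_simps:
  assumes "0 < k" "k \<le> 1"
  shows "r \<le> 1 \<Longrightarrow> shrink_factor k r = k"
    "1 \<le> r \<Longrightarrow> r \<le> 2 \<Longrightarrow> shrink_factor k r = (2 - (2 - k) * (2 - r)) / r"
    "2 \<le> r \<Longrightarrow> shrink_factor k r = 1"
proof -
  \<comment> \<open>These factored differences compare the middle branch with its neighbours. Their
    signs change exactly at \<open>r = 1\<close> and \<open>r = 2\<close>, which decides the
    \<open>min\<close> and \<open>max\<close>.\<close>
  have *: "2 - (2 - k) * (2 - r) - k * r = 2 * (1 - k) * (r - 1)" by (simp add: algebra_simps)
  have **: "r - (2 - (2 - k) * (2 - r)) = (1 - k) * (2 - r)" by (simp add: algebra_simps)
  {
    assume r: "r \<le> 1"
    have "2 - k \<le> (2 - k) * (2 - r)" using mult_left_mono[of 1 "2 - r" "2 - k"] assms r by simp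
    then have "2 - (2 - k) * (2 - r) \<le> k" by linarith
    then show "shrink_factor k r = k" using r assms by (simp add: shrink_factor_def max_def min_def)
  next
    assume r: "1 \<le> r" "r \<le> 2"
    have "2 * (1 - k) * (r - 1) \<ge> 0" "(1 - k) * (2 - r) \<ge> 0" using assms r by auto
    then show "shrink_factor k r = (2 - (2 - k) * (2 - r)) / r"
      using r * ** by (auto simp: shrink_factor_def max_def min_def field_simps)
  next
    assume r: "2 \<le> r"
    have "(1 - k) * (2 - r) \<le> 0" using assms r by (simp add: mult_nonneg_nonpos)
    then show "shrink_factor k r = 1"
      using r * ** assms by (auto simp: shrink_factor_def max_def min_def field_simps)
  }
qed

lemma shrink_factor_one [simp]: "shrink_factor 1 r = 1"
  by (auto simp: shrink_factor_def)

lemma shrink_factor_pos: "0 < k \<Longrightarrow> 0 < shrink_factor k r"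
  by (auto simp: shrink_factor_def)

lemma unshrink_radius_simps:
  assumes "0 < k" "k \<le> 1"
  shows "0 \<le> u \<Longrightarrow> u \<le> k \<Longrightarrow> unshrink_radius k u = u / k"
    "k \<le> u \<Longrightarrow> u \<le> 2 \<Longrightarrow> unshrink_radius k u = 2 - (2 - u) / (2 - k)"
    "2 \<le> u \<Longrightarrow> unshrink_radius k u = u"
proof -
  have *: "2 - (2 - u) / (2 - k) - u / k = 2 * (1 - k) * (k - u) / (k * (2 - k))"
    using assms by (simp add: field_simps)
  have **: "2 - (2 - u) / (2 - k) - u = (1 - k) * (2 - u) / (2 - k)"
    using assms by (simp add: field_simps)
  have ***: "u / k - u = u * (1 - k) / k" using assms by (simp add: field_simps)
  {
    assume u: "0 \<le> u" "u \<le> k"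
    have "2 * (1 - k) * (k - u) / (k * (2 - k)) \<ge> 0" "u * (1 - k) / k \<ge> 0" using assms u by auto
    then show "unshrink_radius k u = u / k" using * *** by (auto simp: unshrink_radius_def)
  next
    assume u: "k \<le> u" "u \<le> 2"
    have "2 * (1 - k) * (u - k) / (k * (2 - k)) \<ge> 0" using assms u by auto
    then have "2 * (1 - k) * (k - u) / (k * (2 - k)) \<le> 0"
      using assms u by (intro divide_nonpos_pos mult_nonneg_nonpos) auto
    moreover have "(1 - k) * (2 - u) / (2 - k) \<ge> 0" using assms u by auto
    ultimately show "unshrink_radius k u = 2 - (2 - u) / (2 - k)"
      using * ** by (auto simp: unshrink_radius_def)
  next
    assume u: "2 \<le> u"
    have "(1 - k) * (2 - u) / (2 - k) \<le> 0" using assms u by (intro divide_nonpos_pos mult_nonneg_nonpos) auto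
    then show "unshrink_radius k u = u" using ** by (auto simp: unshrink_radius_def)
  }
qed

lemma unshrink_radius_inverse:
  assumes k: "0 < k" "k \<le> 1" and "0 \<le> r"
  shows "unshrink_radius k (shrink_factor k r * r) = r"
proof -
  consider "r \<le> 1" | "1 \<le> r" "r \<le> 2" | "2 \<le> r" by linarith
  then show ?thesis
  proof cases
    case 1
    then show ?thesis using assms unshrink_radius_simps(1)[OF k, of "k * r"] 
      by (simp add: shrink_factor_simps mult_left_le)
  next
    case 2
    have "(2 - k) * (2 - r) \<le> 2 - k" using mult_left_mono[of "2 - r" 1 "2 - k"] 2 k by simp
    moreover have "(2 - k) * (2 - r) \<ge> 0" using 2 k by auto
    ultimately have "k \<le> 2 - (2 - k) * (2 - r)" "2 - (2 - k) * (2 - r) \<le> 2" by linarith+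
    then have "unshrink_radius k (2 - (2 - k) * (2 - r)) = 2 - (2 - k) * (2 - r) / (2 - k)"
      using unshrink_radius_simps(2)[OF k, of "2 - (2 - k) * (2 - r)"] by simp
    also have "\<dots> = r" using k by simp
    finally show ?thesis using shrink_factor_simps(2)[OF k] 2 by simp
  next
    case 3
    then show ?thesis using unshrink_radius_simps(3)[OF k] shrink_factor_simps(3)[OF k] by simp
  qed
qed

lemma shrink_unshrink_radius:
  assumes k: "0 < k" "k \<le> 1" and "0 \<le> u"
  shows "shrink_factor k (unshrink_radius k u) * unshrink_radius k u = u"
proof -
  consider "u \<le> k" | "k \<le> u" "u \<le> 2" | "2 \<le> u" by linarith
  then show ?thesis
  proof cases
    case 1
    then show ?thesis using assms by (simp add: unshrink_radius_simps shrink_factor_simps)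
  next
    case 2
    define r where "r = 2 - (2 - u) / (2 - k)"
    have "(2 - u) / (2 - k) \<le> 1" "(2 - u) / (2 - k) \<ge> 0" using 2 k by (auto simp: field_simps)
    then have r: "1 \<le> r" "r \<le> 2" by (auto simp: r_def)
    have "(2 - k) * (2 - r) = 2 - u" using k by (simp add: r_def)
    then have "shrink_factor k r * r = u" using shrink_factor_simps(2)[OF k r] r by simp
    then show ?thesis using unshrink_radius_simps(2)[OF k 2] by (simp add: r_def)
  next
    case 3
    then show ?thesis using unshrink_radius_simps(3)[OF k] shrink_factor_simps(3)[OF k] by simp
  qed
qed

lemma unshrink_shrink: "0 < k \<Longrightarrow> k \<le> 1 \<Longrightarrow> unshrink k (shrink k v) = v"
  using shrink_factor_pos[of k "norm v"] unshrink_radius_inverse[of k "norm v"]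
  by (simp add: shrink_def unshrink_def)

lemma shrink_unshrink:
  assumes k: "0 < k" "k \<le> 1" shows "shrink k (unshrink k w) = w"
proof -
  have "norm (unshrink k w) = unshrink_radius k (norm w)"
    using shrink_unshrink_radius[OF k, of "norm w"] shrink_factor_pos[OF k(1), of "unshrink_radius k (norm w)"]
    by (simp add: unshrink_def field_simps)
  then show ?thesis
    using shrink_factor_pos[OF k(1), of "unshrink_radius k (norm w)"] by (simp add: shrink_def) (simp add: unshrink_def)
qed

lemma shrink_outside: "0 < k \<Longrightarrow> k \<le> 1 \<Longrightarrow> 2 \<le> norm v \<Longrightarrow> shrink k v = v"
  by (simp add: shrink_def shrink_factor_simps)

lemma unshrink_outside: "0 < k \<Longrightarrow> k \<le> 1 \<Longrightarrow> 2 \<le> norm v \<Longrightarrow> unshrink k v = v"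
  by (simp add: unshrink_def shrink_factor_simps unshrink_radius_simps)

lemma shrink_one [simp]: "shrink 1 v = v"
  by (simp add: shrink_def)

lemma norm_shrink_inside: "0 < k \<Longrightarrow> k \<le> 1 \<Longrightarrow> norm v < 1 \<Longrightarrow> norm (shrink k v) < k"
  by (simp add: shrink_def shrink_factor_simps)

lemma continuous_on_shrink_factor:
  assumes "continuous_on S k" "continuous_on S f"
  shows "continuous_on S (\<lambda>x. shrink_factor (k x) (f x))"
  unfolding shrink_factor_def by (intro continuous_intros assms) auto

lemma continuous_on_shrink:
  assumes "continuous_on S k" "continuous_on S f"
  shows "continuous_on S (\<lambda>x. shrink (k x) (f x))"
  unfolding shrink_def by (intro continuous_intros continuous_on_shrink_factor assms)

lemma continuous_on_unshrink:
  assumes "continuous_on S k" "continuous_on S f" "\<And>x. x \<in> S \<Longrightarrow> 0 < k x \<and> k x \<le> 1"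
  shows "continuous_on S (\<lambda>x. unshrink (k x) (f x))"
proof -
  have "shrink_factor (k x) r \<noteq> 0 \<and> k x \<noteq> 0 \<and> 2 - k x \<noteq> 0" if "x \<in> S" for x r
    using shrink_factor_pos[of "k x" r] assms(3)[OF that] by auto
  then show ?thesis
    unfolding unshrink_def unshrink_radius_def
    by (intro continuous_intros continuous_on_shrink_factor assms) auto
qed

text \<open>Any chart can be recentred at \<open>p\<close> and rescaled by a large \<open>R\<close>,
  so that \<open>C\<close> falls into the unit ball, where \<open>shrink\<close> is plain
  scaling.\<close>

lemma cell_chart:
  fixes V :: "'a::euclidean_space set"
  assumes "cell V" "p \<in> V" "compact C" "C \<subseteq> V"
  obtains \<phi> \<psi> where "homeomorphism (UNIV :: 'a set) V \<phi> \<psi>" "\<phi> 0 = p" "\<And>x. x \<in> C \<Longrightarrow> norm (\<psi> x) < 1"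
proof -
  obtain h k where hk: "homeomorphism V (UNIV :: 'a set) h k"
    using assms(1) unfolding cell_def homeomorphic_def by blast
  have "compact (h ` C)"
    using hk assms(3,4) by (meson compact_continuous_image continuous_on_subset homeomorphism_cont1)
  then obtain R where R: "R > 0" "h ` C \<subseteq> ball (h p) R"
    using bounded_subset_ballD[of "h ` C" "h p"] compact_imp_bounded by metis
  define A where "A v = h p + R *\<^sub>R v" for v
  define B where "B w = (w - h p) /\<^sub>R R" for w
  have "homeomorphism UNIV UNIV A B"
  proof (rule homeomorphismI)
    show "continuous_on UNIV A" "continuous_on UNIV B"
      unfolding A_def B_def by (intro continuous_intros)+
  qed (use R in \<open>auto simp: A_def B_def\<close>)
  then have "homeomorphism UNIV V (k \<circ> A) (B \<circ> h)"
    using homeomorphism_compose homeomorphism_symD[OF hk] by blast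
  moreover have "(k \<circ> A) 0 = p" using homeomorphism_apply1[OF hk assms(2)] by (simp add: A_def)
  moreover have "norm ((B \<circ> h) x) < 1" if "x \<in> C" for x
  proof -
    have "norm (h x - h p) < R" using R(2) that by (auto simp: dist_norm norm_minus_commute)
    then show ?thesis using R(1) by (simp add: B_def divide_simps)
  qed
  ultimately show ?thesis using that by blast
qed

section \<open>Orthogonal splittings and motions along one factor\<close>

locale splitting =
  fixes e :: "'b::euclidean_space \<Rightarrow> 'a::euclidean_space" and q :: "'a \<Rightarrow> 'b"
  assumes linear_e: "linear e" and linear_q: "linear q" and q_e [simp]: "q (e v) = v"
    and norm_e [simp]: "norm (e v) = norm v" and norm_q: "norm (q x) \<le> norm x"
    and norm_rest: "norm (x - e (q x)) \<le> norm x"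
begin

definition \<rho> :: "'a \<Rightarrow> 'a" where "\<rho> x = x - e (q x)"

text \<open>The complementary factor stays inside the ambient space: \<open>M\<close> is a set of
  the whole space of which only the trace on the range of \<open>\<rho>\<close> matters. Thus only
  the factor that carries the cells needs a type of its own.\<close>

definition cyl :: "'a set \<Rightarrow> 'b set \<Rightarrow> 'a set" where
  "cyl M V = {x. \<rho> x \<in> M \<and> q x \<in> V}"

lemma linear_\<rho>: "linear \<rho>"
  unfolding \<rho>_def using linear_compose[OF linear_q linear_e]
  by (intro linear_compose_sub) (simp_all add: o_def linear_ident)

lemma norm_\<rho>: "norm (\<rho> x) \<le> norm x"
  using norm_rest by (simp add: \<rho>_def)

lemmas lin_simps = linear_add[OF linear_e] linear_diff[OF linear_e] linear_scale[OF linear_e]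
  linear_add[OF linear_q] linear_diff[OF linear_q] linear_scale[OF linear_q]
  linear_add[OF linear_\<rho>] linear_diff[OF linear_\<rho>] linear_scale[OF linear_\<rho>]

lemma q_\<rho> [simp]: "q (\<rho> x) = 0"
  by (simp add: \<rho>_def lin_simps)

lemma e_0 [simp]: "e 0 = 0"
  by (rule linear_0[OF linear_e])

lemma \<rho>_\<rho> [simp]: "\<rho> (\<rho> x) = \<rho> x"
  by (simp add: \<rho>_def[of "\<rho> x"])

lemma \<rho>_e [simp]: "\<rho> (e v) = 0"
  by (simp add: \<rho>_def)

lemma decomp: "\<rho> x + e (q x) = x"
  by (simp add: \<rho>_def)

lemma continuous_e [continuous_intros]: "continuous_on S f \<Longrightarrow> continuous_on S (\<lambda>x. e (f x))"
  by (rule continuous_on_compose2[OF linear_continuous_on[OF linear_conv_bounded_linear[THEN iffD1, OF linear_e]] _ subset_UNIV])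

lemma continuous_q [continuous_intros]: "continuous_on S f \<Longrightarrow> continuous_on S (\<lambda>x. q (f x))"
  by (rule continuous_on_compose2[OF linear_continuous_on[OF linear_conv_bounded_linear[THEN iffD1, OF linear_q]] _ subset_UNIV])

lemma continuous_\<rho> [continuous_intros]: "continuous_on S f \<Longrightarrow> continuous_on S (\<lambda>x. \<rho> (f x))"
  by (rule continuous_on_compose2[OF linear_continuous_on[OF linear_conv_bounded_linear[THEN iffD1, OF linear_\<rho>]] _ subset_UNIV])

lemma open_cyl: "open M \<Longrightarrow> open V \<Longrightarrow> open (cyl M V)"
  using open_Int[OF open_vimage[OF _ continuous_\<rho>[OF continuous_on_id]] open_vimage[OF _ continuous_q[OF continuous_on_id]], of M V]
  by (simp add: cyl_def vimage_def Int_def)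

lemma norm_le_parts: "norm x \<le> norm (\<rho> x) + norm (q x)"
  using norm_triangle_ineq[of "\<rho> x" "e (q x)"] by (simp add: decomp)

text \<open>The chart need not extend continuously to the boundary of \<open>V\<close>. Continuity
  is obtained on two open sets: where \<open>q x\<close> lies in \<open>V\<close>, and where it
  avoids the compact image of \<open>cball 0 2\<close>; on the latter the map is the identity. The
  radial map \<open>\<tau>\<close> is left open to serve both \<open>shrink\<close> and
  \<open>unshrink\<close>.\<close>

lemma fibrewise_continuous:
  fixes \<phi> \<psi> :: "'b \<Rightarrow> 'b" and \<tau> :: "'k \<Rightarrow> 'b \<Rightarrow> 'b"
  assumes V: "open V" "homeomorphism UNIV V \<phi> \<psi>"
    and \<kappa>: "\<And>x. P (\<kappa> x)"
    and \<tau>: "\<And>f. continuous_on {x. q x \<in> V} f \<Longrightarrow> continuous_on {x. q x \<in> V} (\<lambda>x. \<tau> (\<kappa> (\<rho> x)) (f x))"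
      "\<And>k w. P k \<Longrightarrow> 2 \<le> norm w \<Longrightarrow> \<tau> k w = w"
  shows "continuous_on UNIV (\<lambda>x. if q x \<in> V then \<rho> x + e (\<phi> (\<tau> (\<kappa> (\<rho> x)) (\<psi> (q x)))) else x)"
    (is "continuous_on UNIV ?F")
proof -
  note cont = homeomorphism_cont1[OF V(2)] homeomorphism_cont2[OF V(2)]
  let ?A = "{x. q x \<in> V}" and ?B = "{x. q x \<notin> \<phi> ` cball 0 2}"
  have cont_q: "continuous_on UNIV q" using continuous_q[OF continuous_on_id] by simp
  have "open ?A" using open_vimage[OF V(1) cont_q] by (simp add: vimage_def)
  moreover have "open ?B"
  proof -
    have "closed (\<phi> ` cball 0 2)"
      by (intro compact_imp_closed compact_continuous_image compact_cball continuous_on_subset[OF cont(1)]) simp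
    then have "open (q -` (- \<phi> ` cball 0 2))" using open_vimage[OF _ cont_q] by (simp add: open_Compl)
    then show ?thesis by (simp add: vimage_def)
  qed
  moreover have "continuous_on ?A ?F"
  proof -
    have "continuous_on ?A (\<lambda>x. \<psi> (q x))"
      by (rule continuous_on_compose2[OF cont(2) continuous_q[OF continuous_on_id]]) auto
    from continuous_on_compose2[OF cont(1) \<tau>(1)[OF this] subset_UNIV]
    have "continuous_on ?A (\<lambda>x. \<rho> x + e (\<phi> (\<tau> (\<kappa> (\<rho> x)) (\<psi> (q x)))))"
      by (intro continuous_on_add continuous_e continuous_\<rho> continuous_on_id)
    then show ?thesis by (rule continuous_on_eq) simp
  qed
  moreover have "continuous_on ?B ?F"
  proof -
    have "?F x = x" if "x \<in> ?B" for x
    proof (cases "q x \<in> V")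
      case True
      have eq: "\<phi> (\<psi> (q x)) = q x" using homeomorphism_apply2[OF V(2) True] .
      have "\<psi> (q x) \<notin> cball 0 2"
      proof (rule notI)
        assume "\<psi> (q x) \<in> cball 0 2"
        then have "\<phi> (\<psi> (q x)) \<in> \<phi> ` cball 0 2" by (rule imageI)
        then show False using that unfolding eq by simp
      qed
      then have "2 \<le> norm (\<psi> (q x))" by simp
      then have "\<tau> (\<kappa> (\<rho> x)) (\<psi> (q x)) = \<psi> (q x)" using \<tau>(2)[OF \<kappa>] by blast
      then show ?thesis using True eq by (simp add: decomp)
    next
      case False
      then show ?thesis by simp
    qed
    from continuous_on_eq[OF continuous_on_id this[symmetric]] show ?thesis .
  qed
  ultimately have un: "continuous_on (?A \<union> ?B) ?F" by (rule continuous_on_open_Un)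
  have "x \<in> ?A \<union> ?B" for x
  proof (cases "q x \<in> V")
    case False
    then have "q x \<notin> \<phi> ` UNIV" unfolding homeomorphism_image1[OF V(2)] .
    then have "q x \<notin> \<phi> ` cball 0 2" by (rule contra_subsetD[OF image_mono[OF subset_UNIV]])
    then show ?thesis by simp
  qed simp
  then have "UNIV = ?A \<union> ?B" by (rule UNIV_eq_I)
  with un show ?thesis by (rule forw_subst[of _ _ "\<lambda>S. continuous_on S ?F", rotated])
qed

text \<open>Each slice of constant \<open>\<rho> x\<close> is shrunk in the chart of
  \<open>V\<close> by its own factor \<open>\<kappa> (\<rho> x)\<close>. A Urysohn function makes
  the factor small over the image of \<open>K\<close> and equal to 1 off \<open>M\<close>. Since
  \<open>\<rho>\<close> is preserved, the inverse is found slice by slice; the identity outside the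
  cylinder comes from the factor 1 on the side of \<open>M\<close> and from the chart on the side of
  \<open>V\<close>.\<close>

lemma cylinder_shrink:
  assumes M: "open M" and V: "open V" "cell V" and K: "compact K" "K \<subseteq> cyl M V"
    and p: "p \<in> V" and N: "open N" "p \<in> N"
  obtains s s' where "homeomorphism UNIV UNIV s s'" "\<And>x. x \<notin> cyl M V \<Longrightarrow> s x = x"
    "\<And>x. x \<in> K \<Longrightarrow> \<rho> (s x) = \<rho> x \<and> q (s x) \<in> N"
proof -
  have "compact (q ` K)" by (intro compact_continuous_image K continuous_intros)
  moreover have "q ` K \<subseteq> V" using K(2) by (auto simp: cyl_def)
  ultimately obtain \<phi> \<psi> :: "'b \<Rightarrow> 'b" where chart: "homeomorphism UNIV V \<phi> \<psi>" "\<phi> 0 = p" "\<And>x. x \<in> K \<Longrightarrow> norm (\<psi> (q x)) < 1"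
    using cell_chart[OF V(2) p] by (metis imageI)
  have "continuous_on UNIV \<phi>" using homeomorphism_cont1[OF chart(1)] .
  then have "open (\<phi> -` N)" using N(1) by (simp add: open_vimage)
  then obtain \<delta> where \<delta>: "\<delta> > 0" "ball 0 \<delta> \<subseteq> \<phi> -` N"
    using N(2) chart(2) by (metis openE vimageI2)
  \<comment> \<open>The bound \<open>\<delta>\<close> puts the shrunk points into \<open>N\<close>;
    the bound 1 keeps every factor between \<open>k0\<close> and 1 admissible for
    \<open>shrink\<close>.\<close>
  define k0 where "k0 = min \<delta> 1"
  have k0: "0 < k0" "k0 \<le> 1" "k0 \<le> \<delta>" using \<delta> by (auto simp: k0_def)
  have "compact (\<rho> ` K)" by (intro compact_continuous_image K continuous_intros)
  then have "closedin (top_of_set UNIV) (\<rho> ` K)" by (simp add: compact_imp_closed)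
  moreover have "closedin (top_of_set UNIV) (- M)" using M by (simp add: closed_Compl)
  moreover have "\<rho> ` K \<inter> - M = {}" using K(2) by (auto simp: cyl_def)
  ultimately obtain \<kappa> :: "'a \<Rightarrow> real" where \<kappa>: "continuous_on UNIV \<kappa>"
    "\<And>x. \<kappa> x \<in> closed_segment k0 1" "\<And>x. x \<in> \<rho> ` K \<Longrightarrow> \<kappa> x = k0" "\<And>x. x \<in> - M \<Longrightarrow> \<kappa> x = 1"
    using Urysohn_local[of UNIV "\<rho> ` K" "- M" k0 1] by (metis UNIV_I)
  have \<kappa>01: "0 < \<kappa> x \<and> \<kappa> x \<le> 1" for x
    using \<kappa>(2)[of x] k0 by (auto simp: closed_segment_eq_real_ivl)
  note app = homeomorphism_apply1[OF chart(1)] homeomorphism_apply2[OF chart(1)]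
  have in_V: "\<phi> w \<in> V" for w using homeomorphism_image1[OF chart(1)] by blast
  \<comment> \<open>With the radial map as a parameter, one computation shows that
    \<open>F shrink\<close> and \<open>F unshrink\<close> are mutually inverse.\<close>
  define F where "F \<tau> x = (if q x \<in> V then \<rho> x + e (\<phi> (\<tau> (\<kappa> (\<rho> x)) (\<psi> (q x)))) else x)"
    for \<tau> :: "real \<Rightarrow> 'b \<Rightarrow> 'b" and x
  have q_F: "q (F \<tau> x) = \<phi> (\<tau> (\<kappa> (\<rho> x)) (\<psi> (q x)))" "\<rho> (F \<tau> x) = \<rho> x" if "q x \<in> V" for \<tau> x
    using that by (simp_all add: F_def lin_simps)
  have inv: "F \<tau> (F \<tau>' x) = x" if "\<And>k w. 0 < k \<Longrightarrow> k \<le> 1 \<Longrightarrow> \<tau> k (\<tau>' k w) = w" for \<tau> \<tau>' x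
  proof (cases "q x \<in> V")
    case True
    then have "q (F \<tau>' x) \<in> V" using q_F in_V by simp
    then show ?thesis
      using q_F[OF True, of \<tau>'] app True that \<kappa>01 by (simp add: F_def[of \<tau>] decomp)
  qed (simp add: F_def)
  have cont_\<kappa>: "continuous_on S (\<lambda>x. \<kappa> (\<rho> x))" for S
    by (rule continuous_on_compose2[OF \<kappa>(1)]) (auto intro: continuous_intros)
  have "continuous_on UNIV (F shrink)"
    unfolding F_def using \<kappa>01
    by (intro fibrewise_continuous[OF V(1) chart(1), where P = "\<lambda>k. 0 < k \<and> k \<le> 1"]
        continuous_on_shrink cont_\<kappa>) (auto intro: shrink_outside)
  moreover have "continuous_on UNIV (F unshrink)"
    unfolding F_def using \<kappa>01
    by (intro fibrewise_continuous[OF V(1) chart(1), where P = "\<lambda>k. 0 < k \<and> k \<le> 1"]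
        continuous_on_unshrink cont_\<kappa>) (auto intro: unshrink_outside)
  ultimately have "homeomorphism UNIV UNIV (F shrink) (F unshrink)"
    using inv[of unshrink shrink] inv[of shrink unshrink] unshrink_shrink shrink_unshrink
    by (intro homeomorphismI) auto
  moreover have "F shrink x = x" if "x \<notin> cyl M V" for x
    using that \<kappa>(4)[of "\<rho> x"] app by (auto simp: F_def cyl_def decomp)
  moreover have "\<rho> (F shrink x) = \<rho> x \<and> q (F shrink x) \<in> N" if "x \<in> K" for x
  proof -
    have x: "q x \<in> V" using that K(2) by (auto simp: cyl_def)
    have "norm (shrink k0 (\<psi> (q x))) < k0" using norm_shrink_inside k0 chart(3)[OF that] by blast
    then have "shrink k0 (\<psi> (q x)) \<in> ball 0 \<delta>" using k0 by simp
    then show ?thesis using q_F[OF x] \<kappa>(3)[of "\<rho> x"] that \<delta>(2) by auto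
  qed
  ultimately show ?thesis using that by blast
qed

end

section \<open>From products to cells\<close>

context splitting
begin

text \<open>An affine image of the unit ball, hence visibly a cell, that replaces a product of two balls.\<close>

definition ellipsoid :: "'a \<Rightarrow> real \<Rightarrow> 'b \<Rightarrow> real \<Rightarrow> 'a set" where
  "ellipsoid y d p r = (\<lambda>z. (\<rho> y + d *\<^sub>R \<rho> z) + e (p + r *\<^sub>R q z)) ` ball 0 1"

lemma ellipsoid_parts:
  assumes "x \<in> ellipsoid y d p r" "0 < d" "0 < r"
  shows "dist (\<rho> x) (\<rho> y) < d" "dist (q x) p < r"
proof -
  obtain z where z: "norm z < 1" "x = (\<rho> y + d *\<^sub>R \<rho> z) + e (p + r *\<^sub>R q z)"
    using assms(1) by (auto simp: ellipsoid_def)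
  have "\<rho> x - \<rho> y = d *\<^sub>R \<rho> z" "q x - p = r *\<^sub>R q z"
    unfolding z(2) by (simp_all add: lin_simps)
  moreover have "norm (\<rho> z) < 1" "norm (q z) < 1" using norm_\<rho>[of z] norm_q[of z] z(1) by linarith+
  ultimately show "dist (\<rho> x) (\<rho> y) < d" "dist (q x) p < r"
    using assms(2,3) by (simp_all add: dist_norm)
qed

text \<open>The factor 2 makes both parts of the preimage shorter than 1/2, so the triangle
  inequality already places it in the unit ball.\<close>

lemma in_ellipsoid:
  assumes "2 * dist (\<rho> x) (\<rho> y) < d" "2 * dist (q x) p < r"
  shows "x \<in> ellipsoid y d p r"
proof -
  define z where "z = (\<rho> x - \<rho> y) /\<^sub>R d + e ((q x - p) /\<^sub>R r)"
  have pos: "d > 0" "r > 0" using assms by (smt (verit) zero_le_dist)+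
  have z: "\<rho> z = (\<rho> x - \<rho> y) /\<^sub>R d" "q z = (q x - p) /\<^sub>R r"
    by (simp_all add: z_def lin_simps)
  have "norm (\<rho> z) < 1/2" "norm (q z) < 1/2"
    using assms pos unfolding z dist_norm norm_scaleR by (simp_all add: field_simps)
  then have "norm z < 1" using norm_le_parts[of z] by linarith
  moreover have "(\<rho> y + d *\<^sub>R \<rho> z) + e (p + r *\<^sub>R q z) = x"
    using pos decomp[of x] by (simp add: z)
  ultimately show ?thesis unfolding ellipsoid_def by (intro image_eqI[of _ _ z]) auto
qed

lemma cell_ellipsoid:
  assumes "0 < d" "0 < r"
  shows "open (ellipsoid y d p r)" "cell (ellipsoid y d p r)"
proof -
  let ?f = "\<lambda>z. (\<rho> y + d *\<^sub>R \<rho> z) + e (p + r *\<^sub>R q z)"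
  let ?g = "\<lambda>x. (\<rho> x - \<rho> y) /\<^sub>R d + e ((q x - p) /\<^sub>R r)"
  have inv: "?g (?f z) = z" "?f (?g z) = z" for z
    using assms decomp[of z] by (simp_all add: lin_simps)
  have hom: "homeomorphism UNIV UNIV ?f ?g"
    by (rule homeomorphismI) (intro continuous_intros | simp only: inv subset_UNIV)+
  then have "homeomorphism (ball 0 1) (ellipsoid y d p r) ?f ?g"
    unfolding ellipsoid_def by (rule homeomorphism_of_subsets) auto
  then have "ball (0::'a) 1 homeomorphic ellipsoid y d p r" unfolding homeomorphic_def by blast
  then show "cell (ellipsoid y d p r)"
    unfolding cell_def using homeomorphic_ball01_UNIV homeomorphic_sym homeomorphic_trans by blast
  have "ellipsoid y d p r = ?g -` ball 0 1"
  proof (intro set_eqI iffI)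
    fix x assume "x \<in> ellipsoid y d p r"
    then obtain z where z: "z \<in> ball 0 1" "x = ?f z" unfolding ellipsoid_def by (rule imageE)
    show "x \<in> ?g -` ball 0 1" unfolding z(2) vimage_eq inv(1) by (rule z(1))
  next
    fix x assume "x \<in> ?g -` ball 0 1"
    then have "?g x \<in> ball 0 1" by (rule vimageD)
    then have "?f (?g x) \<in> ?f ` ball 0 1" by (rule imageI)
    then show "x \<in> ellipsoid y d p r" unfolding ellipsoid_def inv(2) .
  qed
  then show "open (ellipsoid y d p r)"
    using open_vimage[OF open_ball homeomorphism_cont2[OF hom], of 0 1] by (rule ssubst)
qed

text \<open>The ellipsoids \<open>D i\<close> are wide in the direction of \<open>\<rho>\<close>,
  where nothing is moved, and so thin in the direction of \<open>q\<close> that the distinct heights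
  \<open>p i\<close> alone separate them. One homeomorphism \<open>h\<close> pushes every piece of
  \<open>X\<close> into its ellipsoid, and the preimages \<open>W i\<close> are the desired
  cells.\<close>

lemma fine_cover_cell_of_cylinders:
  assumes X: "compact X"
    and cyls: "\<And>d. d > 0 \<Longrightarrow> \<exists>I. finite I \<and>
      (\<forall>(M, V)\<in>I. open M \<and> small d M \<and> open V \<and> small d V \<and> cell V) \<and>
      (\<forall>(M, V)\<in>I. \<forall>(M', V')\<in>I. (M, V) \<noteq> (M', V') \<longrightarrow> M \<inter> M' = {} \<or> V \<inter> V' = {}) \<and>
      X \<subseteq> (\<Union>(M, V)\<in>I. cyl M V)"
  shows "fine_cover cell X"
  unfolding fine_cover_def
proof (intro allI impI)
  fix \<epsilon> :: real assume "\<epsilon> > 0"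
  \<comment> \<open>An ellipsoid has size below \<open>6 * d\<close>, and \<open>h\<close> displaces
    each of two points by less than \<open>2 * d\<close>; the total \<open>10 * d\<close> stays
    below \<open>12 * d\<close>.\<close>
  define d where "d = \<epsilon> / 12"
  have d: "d > 0" using \<open>\<epsilon> > 0\<close> by (simp add: d_def)
  obtain I0 where I0: "finite I0"
    "\<forall>(M, V)\<in>I0. open M \<and> small d M \<and> open V \<and> small d V \<and> cell V"
    "\<forall>(M, V)\<in>I0. \<forall>(M', V')\<in>I0. (M, V) \<noteq> (M', V') \<longrightarrow> M \<inter> M' = {} \<or> V \<inter> V' = {}"
    "X \<subseteq> (\<Union>(M, V)\<in>I0. cyl M V)"
    using cyls[OF d] by blast
  define C where "C i = cyl (fst i) (snd i)" for i
  \<comment> \<open>Products that miss \<open>X\<close> are dropped, since a point of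
    \<open>X\<close> in each one serves to centre the ellipsoid.\<close>
  define I where "I = {i \<in> I0. X \<inter> C i \<noteq> {}}"
  have I: "finite I" "\<And>i. i \<in> I \<Longrightarrow> open (fst i)" "\<And>i. i \<in> I \<Longrightarrow> small d (fst i)" "\<And>i. i \<in> I \<Longrightarrow> open (snd i)"
    "\<And>i. i \<in> I \<Longrightarrow> small d (snd i)" "\<And>i. i \<in> I \<Longrightarrow> cell (snd i)" "\<And>i. i \<in> I \<Longrightarrow> X \<inter> C i \<noteq> {}"
    using I0(1,2) by (fastforce simp: I_def)+
  have disj: "C i \<inter> C j = {}" if "i \<in> I" "j \<in> I" "i \<noteq> j" for i j
  proof -
    have "fst i \<inter> fst j = {} \<or> snd i \<inter> snd j = {}" using I0(3) that by (fastforce simp: I_def)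
    then show ?thesis by (auto simp: C_def cyl_def)
  qed
  have cover: "X \<subseteq> (\<Union>i\<in>I. C i)" using I0(4) by (fastforce simp: I_def C_def)
  have opC: "open (C i)" if "i \<in> I" for i using I(2,4) that by (simp add: C_def open_cyl)
  have cptC: "compact (X \<inter> C i)" if "i \<in> I" for i
  proof (rule compact_Int_disjoint_cover[OF X, of "C ` I"])
    show "disjoint (C ` I)" using disj unfolding disjoint_def by blast
  qed (use opC cover that in auto)
  \<comment> \<open>Different products may share the same \<open>V\<close>, so the heights
    \<open>p i\<close> have to be chosen distinct; a nonempty open set is infinite.\<close>
  have "\<exists>p. inj_on p I \<and> (\<forall>i\<in>I. p i \<in> snd i)"
  proof (rule distinct_representatives[OF I(1)])
    show "infinite (snd i)" if "i \<in> I" for i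
      using finite_imp_not_open[OF _ I(4)[OF that]] cell_nonempty[OF I(6)[OF that]] by blast
  qed
  then obtain p where p: "inj_on p I" "\<And>i. i \<in> I \<Longrightarrow> p i \<in> snd i" by blast
  have "\<exists>z. z \<in> X \<inter> C i" if "i \<in> I" for i using I(7)[OF that] by blast
  then obtain x where x: "\<And>i. i \<in> I \<Longrightarrow> x i \<in> X \<inter> C i" by metis
  have "\<exists>r0>0. \<forall>i\<in>I. \<forall>j\<in>I. i \<noteq> j \<longrightarrow> 2 * r0 \<le> dist (p i) (p j)"
  proof (rule uniform_positive_bound_pairs[OF I(1)])
    show "\<exists>r>0. 2 * r \<le> dist (p i) (p j)" if "i \<in> I" "j \<in> I" "i \<noteq> j" for i j
      using inj_onD[OF p(1) _ that(1,2)] that(3) by (intro exI[of _ "dist (p i) (p j) / 2"]) auto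
  qed auto
  then obtain r0 where r0: "r0 > 0" "\<And>i j. i \<in> I \<Longrightarrow> j \<in> I \<Longrightarrow> i \<noteq> j \<Longrightarrow> 2 * r0 \<le> dist (p i) (p j)"
    by blast
  define r where "r = min r0 d"
  have r: "r > 0" "r \<le> d" "\<And>i j. i \<in> I \<Longrightarrow> j \<in> I \<Longrightarrow> i \<noteq> j \<Longrightarrow> 2 * r \<le> dist (p i) (p j)"
  proof -
    show "2 * r \<le> dist (p i) (p j)" if "i \<in> I" "j \<in> I" "i \<noteq> j" for i j
      using r0(2)[OF that] unfolding r_def by linarith
  qed (use r0(1) d in \<open>auto simp: r_def\<close>)
  \<comment> \<open>The radii are twice the size of \<open>M\<close> and twice the radius
    \<open>r/2\<close> of the target balls, to match the factor 2 in
    \<open>in_ellipsoid\<close>.\<close>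
  define D where "D i = ellipsoid (x i) (2 * d) (p i) r" for i
  have D: "open (D i)" "cell (D i)" for i using cell_ellipsoid d r by (simp_all add: D_def)
  have D_parts: "dist (\<rho> z) (\<rho> (x i)) < 2 * d \<and> dist (q z) (p i) < r" if "z \<in> D i" for z i
    using ellipsoid_parts[OF that[unfolded D_def]] d r(1) by simp
  have D_disj: "D i \<inter> D j = {}" if "i \<in> I" "j \<in> I" "i \<noteq> j" for i j
  proof (rule ccontr)
    assume "D i \<inter> D j \<noteq> {}"
    then obtain z where "z \<in> D i" "z \<in> D j" by blast
    then have "dist (q z) (p i) < r" "dist (q z) (p j) < r" using D_parts by blast+
    then show False using r(3)[OF that] dist_triangle3[of "p i" "p j" "q z"] by linarith
  qed
  define S where "S i t \<longleftrightarrow> homeomorphism UNIV UNIV (fst t) (snd t) \<and> (\<forall>z. z \<notin> C i \<longrightarrow> fst t z = z) \<and>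
      (\<forall>z\<in>X \<inter> C i. \<rho> (fst t z) = \<rho> z \<and> q (fst t z) \<in> ball (p i) (r/2))" for i and t :: "('a \<Rightarrow> 'a) \<times> ('a \<Rightarrow> 'a)"
  have "\<exists>t. S i t" if i: "i \<in> I" for i
  proof -
    have sub: "X \<inter> C i \<subseteq> cyl (fst i) (snd i)" by (simp add: C_def)
    have pin: "p i \<in> ball (p i) (r/2)" using r(1) by simp
    obtain s s' where "homeomorphism UNIV UNIV s s'" "\<And>z. z \<notin> cyl (fst i) (snd i) \<Longrightarrow> s z = z"
      "\<And>z. z \<in> X \<inter> C i \<Longrightarrow> \<rho> (s z) = \<rho> z \<and> q (s z) \<in> ball (p i) (r/2)"
      using cylinder_shrink[OF I(2)[OF i] I(4)[OF i] I(6)[OF i] cptC[OF i] sub p(2)[OF i] open_ball pin] by blast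
    then have "S i (s, s')" unfolding S_def C_def by simp
    then show ?thesis by blast
  qed
  then obtain t where t: "\<And>i. i \<in> I \<Longrightarrow> S i (t i)" by metis
  define s where "s i = fst (t i)" for i
  define s' where "s' i = snd (t i)" for i
  have s': "\<And>i. i \<in> I \<Longrightarrow> homeomorphism UNIV UNIV (s i) (s' i)" and
    s: "\<And>i z. i \<in> I \<Longrightarrow> z \<notin> C i \<Longrightarrow> s i z = z"
    "\<And>i z. i \<in> I \<Longrightarrow> z \<in> X \<inter> C i \<Longrightarrow> \<rho> (s i z) = \<rho> z \<and> q (s i z) \<in> ball (p i) (r/2)"
    using t unfolding S_def s_def s'_def by blast+
  have "\<exists>h h'. homeomorphism UNIV UNIV h h' \<and> (\<forall>i\<in>I. \<forall>z\<in>C i. h z = s i z) \<and>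
      (\<forall>z. z \<notin> (\<Union>i\<in>I. C i) \<longrightarrow> h z = z)"
    by (rule glue_homeomorphisms[OF I(1)]) (fact s' s(1) disj)+
  then obtain h h' where h: "homeomorphism UNIV UNIV h h'" "\<forall>i\<in>I. \<forall>z\<in>C i. h z = s i z"
    "\<forall>z. z \<notin> (\<Union>i\<in>I. C i) \<longrightarrow> h z = z"
    by (elim exE conjE)
  have move: "dist z (h z) < 2 * d" for z
  proof (cases "z \<in> (\<Union>i\<in>I. C i)")
    case True
    then obtain i where i: "i \<in> I" "z \<in> C i" by blast
    then have "h z \<in> C i" using homeomorphism_support[OF s'[OF i(1)] s(1)[OF i(1)], where x = z] h(2) i by metis
    then have "dist (\<rho> z) (\<rho> (h z)) < d" "dist (q z) (q (h z)) < d"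
      using i I(3,5) by (auto simp: C_def cyl_def small_def)
    then show ?thesis
      using norm_le_parts[of "z - h z"] by (simp add: dist_norm lin_simps)
  next
    case False
    then show ?thesis using h(3) d by simp
  qed
  \<comment> \<open>\<open>D i\<close> may stick out of \<open>C i\<close>, so the size of
    \<open>W i\<close> has to come from the uniform displacement bound \<open>move\<close>.\<close>
  define W where "W i = h -` D i" for i
  have W_iff: "z \<in> W i \<longleftrightarrow> h z \<in> D i" for z i
    by (simp add: W_def)
  have "open (W i)" for i
    unfolding W_def using open_vimage[OF D(1) homeomorphism_cont1[OF h(1)]] .
  moreover have "cell (W i)" for i
  proof -
    have "h ` W i = D i" using homeomorphism_image1[OF h(1)] by (simp add: W_def)
    then have "homeomorphism (W i) (D i) h h'"
      by (intro homeomorphism_of_subsets[OF h(1)]) simp_all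
    then have "W i homeomorphic D i" unfolding homeomorphic_def by blast
    then show ?thesis using D(2) homeomorphic_trans unfolding cell_def by blast
  qed
  moreover have "small \<epsilon> (W i)" for i
    unfolding small_def
  proof (intro ballI)
    fix a b assume "a \<in> W i" "b \<in> W i"
    then have "dist (\<rho> (h a)) (\<rho> (x i)) < 2 * d" "dist (q (h a)) (p i) < r"
      "dist (\<rho> (h b)) (\<rho> (x i)) < 2 * d" "dist (q (h b)) (p i) < r"
      using D_parts W_iff by blast+
    then have "dist (\<rho> (h a)) (\<rho> (h b)) < 4 * d" "dist (q (h a)) (q (h b)) < 2 * r"
      using dist_triangle2[of "\<rho> (h a)" "\<rho> (h b)" "\<rho> (x i)"] dist_triangle2[of "q (h a)" "q (h b)" "p i"] by linarith+
    then have "dist (h a) (h b) < 6 * d"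
      using norm_le_parts[of "h a - h b"] r(2) by (simp add: dist_norm lin_simps)
    then show "dist a b < \<epsilon>"
      using move[of a] move[of b] dist_triangle[of a b "h a"] dist_triangle[of "h a" b "h b"]
        \<open>\<epsilon> > 0\<close> by (simp add: d_def dist_commute)
  qed
  moreover have "disjoint (W ` I)"
    unfolding disjoint_def
  proof (intro ballI impI, elim imageE)
    fix A B i j assume "i \<in> I" "j \<in> I" "A = W i" "B = W j" "A \<noteq> B"
    then have "D i \<inter> D j = {}" using D_disj[of i j] by blast
    then show "A \<inter> B = {}" unfolding \<open>A = W i\<close> \<open>B = W j\<close> W_def by blast
  qed
  moreover have "X \<subseteq> \<Union>(W ` I)"
  proof
    fix z assume z: "z \<in> X"
    then obtain i where i: "i \<in> I" "z \<in> C i" using cover by blast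
    then have "\<rho> (h z) = \<rho> z" "dist (q (h z)) (p i) < r/2"
      using s(2)[of i z] h(2) z by (auto simp: dist_commute)
    moreover have "dist (\<rho> z) (\<rho> (x i)) < d"
      using i x[OF i(1)] I(3)[OF i(1)] by (auto simp: C_def cyl_def small_def)
    ultimately have "h z \<in> D i" unfolding D_def by (intro in_ellipsoid) auto
    then show "z \<in> \<Union>(W ` I)" using i W_iff by blast
  qed
  ultimately show "\<exists>\<V>. finite \<V> \<and> disjoint \<V> \<and> (\<forall>V\<in>\<V>. open V \<and> small \<epsilon> V \<and> cell V) \<and> X \<subseteq> \<Union>\<V>"
    using I(1) by (intro exI[of _ "W ` I"]) auto
qed

end

section \<open>The taming criterion\<close>

text \<open>This is \<open>cylinder_shrink\<close> for the trivial splitting: the complementary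
  factor is zero, and the cylinder over \<open>UNIV\<close> is \<open>V\<close> itself.\<close>

lemma cell_shrink:
  fixes V :: "'a::euclidean_space set"
  assumes "open V" "cell V" "compact K" "K \<subseteq> V" "p \<in> V" "open N" "p \<in> N"
  shows "\<exists>s s'. homeomorphism UNIV UNIV s s' \<and> (\<forall>x. x \<notin> V \<longrightarrow> s x = x) \<and> (\<forall>x\<in>K. s x \<in> N)"
proof -
  have sp: "splitting (\<lambda>x::'a. x) (\<lambda>x. x)" by (rule splitting.intro) (auto simp: linear_ident)
  let ?cyl = "splitting.cyl (\<lambda>x::'a. x) (\<lambda>x. x) UNIV V"
  have cyl: "?cyl = V" by (simp only: splitting.cyl_def[OF sp] UNIV_I simp_thms Collect_mem_eq)
  have "K \<subseteq> ?cyl" unfolding cyl by (rule assms(4))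
  then show ?thesis
  proof (rule splitting.cylinder_shrink[OF sp open_UNIV assms(1-3) _ assms(5-7)])
    fix s s' assume s: "homeomorphism UNIV UNIV s s'" "\<And>x. x \<notin> ?cyl \<Longrightarrow> s x = x"
      "\<And>x. x \<in> K \<Longrightarrow> splitting.\<rho> (\<lambda>x::'a. x) (\<lambda>x. x) (s x) = splitting.\<rho> (\<lambda>x::'a. x) (\<lambda>x. x) x \<and> s x \<in> N"
    show ?thesis
      by (intro exI[of _ s] exI[of _ s'] conjI allI impI ballI s(1) s(2)[unfolded cyl] s(3)[THEN conjunct2])
  qed
qed

lemma glue_homeomorphisms_support:
  fixes h :: "'i \<Rightarrow> 'a::topological_space \<Rightarrow> 'a"
  assumes "finite I" "\<And>i. i \<in> I \<Longrightarrow> homeomorphism UNIV UNIV (h i) (h' i)"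
    "\<And>i x. i \<in> I \<Longrightarrow> x \<notin> C i \<Longrightarrow> h i x = x"
    "\<And>i j. i \<in> I \<Longrightarrow> j \<in> I \<Longrightarrow> i \<noteq> j \<Longrightarrow> C i \<inter> C j = {}"
  shows "\<exists>g g'. homeomorphism UNIV UNIV g g' \<and> (\<forall>i\<in>I. \<forall>x\<in>C i. g x = h i x) \<and>
    (\<forall>x. x \<notin> (\<Union>i\<in>I. C i) \<longrightarrow> g x = x) \<and> (\<forall>i\<in>I. \<forall>x. g x \<in> C i \<longleftrightarrow> x \<in> C i)"
proof -
  have "\<exists>g g'. homeomorphism UNIV UNIV g g' \<and> (\<forall>i\<in>I. \<forall>x\<in>C i. g x = h i x) \<and> (\<forall>x. x \<notin> (\<Union>i\<in>I. C i) \<longrightarrow> g x = x)"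
    by (rule glue_homeomorphisms[OF assms(1)]) (fact assms)+
  then obtain g g' where g: "homeomorphism UNIV UNIV g g'" "\<forall>i\<in>I. \<forall>x\<in>C i. g x = h i x"
    "\<forall>x. x \<notin> (\<Union>i\<in>I. C i) \<longrightarrow> g x = x"
    by (elim exE conjE)
  have into: "g x \<in> C i" if "i \<in> I" "x \<in> C i" for i x
  proof -
    have "h i x \<in> C i" using homeomorphism_support[OF assms(2,3)[OF that(1)], where x = x] that(2) by simp
    then show ?thesis using g(2) that by simp
  qed
  have "g x \<in> C i \<longleftrightarrow> x \<in> C i" if i: "i \<in> I" for i x
  proof
    assume gx: "g x \<in> C i"
    show "x \<in> C i"
    proof (cases "x \<in> (\<Union>i\<in>I. C i)")
      case True
      then obtain j where j: "j \<in> I" "x \<in> C j" by blast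
      then have "g x \<in> C j" by (rule into)
      then have "i = j" using assms(4)[OF i j(1)] gx by blast
      then show ?thesis using j by simp
    next
      case False
      then show ?thesis using g(3) gx by simp
    qed
  qed (rule into[OF i])
  with g show ?thesis by (intro exI[of _ g] exI[of _ g']) blast
qed

text \<open>
  One step of the taming process: \<open>h\<close> (with inverse \<open>g\<close>) has moved \<open>X\<close> into the disjoint balls of radius \<open>r\<close>
  about finitely many points of the target line \<open>L\<close>. A later stage that refines it only moves
  points within these balls.
\<close>

definition stage :: "'a::euclidean_space set \<Rightarrow> 'a set \<Rightarrow> ('a \<Rightarrow> 'a) \<Rightarrow> ('a \<Rightarrow> 'a) \<Rightarrow> 'a set \<Rightarrow> real \<Rightarrow> bool" where
  "stage X L h g F r \<longleftrightarrow> homeomorphism UNIV UNIV h g \<and> finite F \<and> F \<subseteq> L \<and> r > 0 \<and>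
     (\<forall>c\<in>F. \<forall>c'\<in>F. c \<noteq> c' \<longrightarrow> ball c r \<inter> ball c' r = {}) \<and> h ` X \<subseteq> (\<Union>c\<in>F. ball c r)"

definition refines :: "('a::euclidean_space \<Rightarrow> 'a) \<Rightarrow> 'a set \<Rightarrow> real \<Rightarrow> ('a \<Rightarrow> 'a) \<Rightarrow> bool" where
  "refines g F r h' \<longleftrightarrow> (\<forall>x. x \<notin> (\<Union>c\<in>F. ball c r) \<longrightarrow> h' (g x) = x) \<and>
     (\<forall>c\<in>F. \<forall>x\<in>ball c r. h' (g x) \<in> ball c r)"

text \<open>The new map is \<open>m \<circ> h \<circ> s\<close>. After \<open>h\<close>,
  \<open>m\<close> moves one marked point of each small cell \<open>W\<close> onto \<open>L\<close>
  inside the old balls; before \<open>h\<close>, \<open>s\<close> shrinks the piece of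
  \<open>X\<close> in \<open>W\<close> towards the marked point. As \<open>s\<close> acts in the
  source and preserves every \<open>W\<close>, the inverse map carries each new ball into one small
  cell, which controls the inverses, while the old balls control the forward maps.\<close>

lemma stage_refine:
  fixes X :: "'a::euclidean_space set"
  assumes dim: "2 \<le> DIM('a)" and X: "compact X" "fine_cover cell X"
    and L: "\<And>c r. c \<in> L \<Longrightarrow> r > 0 \<Longrightarrow> infinite (L \<inter> ball c r)"
    and st: "stage X L h g F r" and "\<eta> > 0"
  shows "\<exists>h' g' F' r'. stage X L h' g' F' r' \<and> r' \<le> \<eta> \<and> (\<forall>c\<in>F'. small \<eta> (g' ` ball c r')) \<and> refines g F r h'"
proof -
  have h: "homeomorphism UNIV UNIV h g" and F: "finite F" "F \<subseteq> L" "r > 0"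
    "\<And>c c'. c \<in> F \<Longrightarrow> c' \<in> F \<Longrightarrow> c \<noteq> c' \<Longrightarrow> ball c r \<inter> ball c' r = {}"
    and hX: "h ` X \<subseteq> (\<Union>c\<in>F. ball c r)"
    using st unfolding stage_def by blast+
  have hg: "h (g x) = x" and gh: "g (h x) = x" for x
    using homeomorphism_apply1[OF h] homeomorphism_apply2[OF h] by auto
  have "X \<subseteq> \<Union>((\<lambda>c. h -` ball c r) ` F)" using hX by blast
  moreover have "open G" if "G \<in> (\<lambda>c. h -` ball c r) ` F" for G
    using that open_vimage[OF open_ball homeomorphism_cont1[OF h]] by blast
  \<comment> \<open>A Lebesgue number: \<open>h\<close> carries every cell of smaller size that
    meets \<open>X\<close> into a single old ball.\<close>
  ultimately obtain \<delta> where \<delta>: "\<delta> > 0" "\<forall>x\<in>X. \<exists>G\<in>(\<lambda>c. h -` ball c r) ` F. ball x \<delta> \<subseteq> G"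
    using Heine_Borel_lemma[OF X(1)] by metis
  obtain \<V> where \<V>: "finite \<V>" "disjoint \<V>" "\<And>V. V \<in> \<V> \<Longrightarrow> open V"
    "\<And>V. V \<in> \<V> \<Longrightarrow> small (min \<delta> \<eta>) V" "\<And>V. V \<in> \<V> \<Longrightarrow> cell V" "X \<subseteq> \<Union>\<V>"
    using fine_coverE[OF X(2), of "min \<delta> \<eta>"] \<delta>(1) \<open>\<eta> > 0\<close> by (metis min_less_iff_conj)
  define \<W> where "\<W> = {V \<in> \<V>. X \<inter> V \<noteq> {}}"
  have \<W>: "finite \<W>" "\<And>V. V \<in> \<W> \<Longrightarrow> open V" "\<And>V. V \<in> \<W> \<Longrightarrow> cell V" "X \<subseteq> \<Union>\<W>"
    using \<V>(1,3,5) \<V>(6) unfolding \<W>_def by (simp, blast, blast, blast)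
  have disj: "V \<inter> W = {}" if "V \<in> \<W>" "W \<in> \<W>" "V \<noteq> W" for V W
    using \<V>(2) that unfolding \<W>_def disjoint_def by blast
  have "\<exists>c\<in>F. W \<subseteq> h -` ball c r" if W: "W \<in> \<W>" for W
  proof -
    obtain x where x: "x \<in> X" "x \<in> W" using W unfolding \<W>_def by blast
    then have "W \<subseteq> ball x \<delta>" using \<V>(4) W unfolding \<W>_def small_def by auto
    then show ?thesis using \<delta>(2) x(1) by (metis (no_types, lifting) imageE order_trans)
  qed
  then obtain c where c: "\<And>W. W \<in> \<W> \<Longrightarrow> c W \<in> F" "\<And>W. W \<in> \<W> \<Longrightarrow> W \<subseteq> h -` ball (c W) r" by metis
  have "\<exists>x. x \<in> W" if "W \<in> \<W>" for W using that unfolding \<W>_def by blast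
  then obtain w where w: "\<And>W. W \<in> \<W> \<Longrightarrow> w W \<in> W" by metis
  \<comment> \<open>Several cells may go to the same old ball, so their targets on \<open>L\<close>
    must be chosen distinct.\<close>
  have "\<exists>t. inj_on t \<W> \<and> (\<forall>W\<in>\<W>. t W \<in> L \<inter> ball (c W) r)"
  proof (rule distinct_representatives[OF \<W>(1)])
    show "infinite (L \<inter> ball (c W) r)" if "W \<in> \<W>" for W
      using L[OF _ F(3)] c(1)[OF that] F(2) by blast
  qed
  then obtain t where t: "inj_on t \<W>" "\<And>W. W \<in> \<W> \<Longrightarrow> t W \<in> L" "\<And>W. W \<in> \<W> \<Longrightarrow> t W \<in> ball (c W) r" by blast
  define S where "S d f \<longleftrightarrow> homeomorphism UNIV UNIV (fst f) (snd f) \<and> (\<forall>x. x \<notin> ball d r \<longrightarrow> fst f x = x) \<and>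
      (\<forall>W\<in>\<W>. c W = d \<longrightarrow> fst f (h (w W)) = t W)" for d and f :: "('a \<Rightarrow> 'a) \<times> ('a \<Rightarrow> 'a)"
  \<comment> \<open>Dimension at least 2 enters here: in a ball of the line, the order of the marked
    points would obstruct moving them to arbitrary targets.\<close>
  have "\<exists>f. S d f" if d: "d \<in> F" for d
  proof -
    have aff: "UNIV \<subseteq> affine hull (ball d r)" using affine_hull_open[of "ball d r"] F(3) by simp
    have fin: "finite {W \<in> \<W>. c W = d}" using \<W>(1) by simp
    have mem: "h (w W) \<in> ball d r \<and> t W \<in> ball d r" if "W \<in> {W \<in> \<W>. c W = d}" for W
      using that w[of W] c(2)[of W] t(3)[of W] by blast
    have pw: "pairwise (\<lambda>V W. h (w V) \<noteq> h (w W) \<and> t V \<noteq> t W) {W \<in> \<W>. c W = d}"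
      unfolding pairwise_def
    proof (intro ballI impI conjI)
      fix V W assume VW: "V \<in> {W \<in> \<W>. c W = d}" "W \<in> {W \<in> \<W>. c W = d}" "V \<noteq> W"
      show "t V \<noteq> t W" using t(1) VW by (auto dest: inj_onD)
      have "w V \<noteq> w W" using disj[of V W] w[of V] w[of W] VW by auto
      then show "h (w V) \<noteq> h (w W)" using gh by metis
    qed
    have "\<exists>f f'. homeomorphism UNIV UNIV f f' \<and> (\<forall>W\<in>{W \<in> \<W>. c W = d}. f (h (w W)) = t W) \<and>
        {x. \<not> (f x = x \<and> f' x = x)} \<subseteq> ball d r"
      by (rule homeomorphism_moving_points_exists[OF dim open_ball connected_ball subset_UNIV fin mem pw subset_UNIV aff connected_ball],
          assumption, intro exI conjI ballI; (assumption | blast))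
    then obtain f f' where f: "homeomorphism UNIV UNIV f f'" "\<forall>W\<in>{W \<in> \<W>. c W = d}. f (h (w W)) = t W"
      "{x. \<not> (f x = x \<and> f' x = x)} \<subseteq> ball d r"
      by (elim exE conjE)
    then have "S d (f, f')" unfolding S_def by auto
    then show ?thesis by blast
  qed
  then obtain f where f: "\<And>d. d \<in> F \<Longrightarrow> S d (f d)" by metis
  have f1: "\<And>d. d \<in> F \<Longrightarrow> homeomorphism UNIV UNIV (fst (f d)) (snd (f d))"
    and f2: "\<And>d x. d \<in> F \<Longrightarrow> x \<notin> ball d r \<Longrightarrow> fst (f d) x = x"
    and f3: "\<And>W. W \<in> \<W> \<Longrightarrow> fst (f (c W)) (h (w W)) = t W"
    using f c(1) unfolding S_def by blast+
  have "\<exists>m m'. homeomorphism UNIV UNIV m m' \<and> (\<forall>d\<in>F. \<forall>x\<in>ball d r. m x = fst (f d) x) \<and>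
    (\<forall>x. x \<notin> (\<Union>d\<in>F. ball d r) \<longrightarrow> m x = x) \<and> (\<forall>d\<in>F. \<forall>x. m x \<in> ball d r \<longleftrightarrow> x \<in> ball d r)"
    by (rule glue_homeomorphisms_support[OF F(1)]) (fact f1 f2 F(4))+
  then obtain m m' where m: "homeomorphism UNIV UNIV m m'" "\<forall>d\<in>F. \<forall>x\<in>ball d r. m x = fst (f d) x"
    "\<forall>x. x \<notin> (\<Union>d\<in>F. ball d r) \<longrightarrow> m x = x" "\<forall>d\<in>F. \<forall>x. m x \<in> ball d r \<longleftrightarrow> x \<in> ball d r"
    by (elim exE conjE)
  have mw: "m (h (w W)) = t W" if "W \<in> \<W>" for W
  proof -
    have "h (w W) \<in> ball (c W) r" using c(2)[OF that] w[OF that] by blast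
    then show ?thesis using m(2) c(1)[OF that] f3[OF that] by simp
  qed
  define k where "k = m \<circ> h"
  define k' where "k' = g \<circ> m'"
  have k: "homeomorphism UNIV UNIV k k'" unfolding k_def k'_def by (rule homeomorphism_compose[OF h m(1)])
  have k'k: "k' (k x) = x" for x using homeomorphism_apply1[OF k] by simp
  \<comment> \<open>Pulling the new balls back into the disjoint cells makes the balls themselves
    disjoint and bounds the size of their preimages.\<close>
  have "\<exists>r'>0. \<forall>W\<in>\<W>. ball (t W) r' \<subseteq> k' -` W"
  proof (rule uniform_positive_bound[OF \<W>(1)])
    show "\<exists>r'>0. ball (t W) r' \<subseteq> k' -` W" if W: "W \<in> \<W>" for W
    proof -
      have "open (k' -` W)" using open_vimage[OF \<W>(2)[OF W] homeomorphism_cont2[OF k]] .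
      moreover have "t W \<in> k' -` W" using k'k[of "w W"] mw[OF W] w[OF W] by (simp add: k_def)
      ultimately show ?thesis using open_contains_ball by blast
    qed
  qed auto
  then obtain r0 where r0: "r0 > 0" "\<And>W. W \<in> \<W> \<Longrightarrow> ball (t W) r0 \<subseteq> k' -` W" by blast
  define r' where "r' = min r0 \<eta>"
  have r': "r' > 0" "r' \<le> \<eta>" using r0(1) \<open>\<eta> > 0\<close> by (auto simp: r'_def)
  have into: "k' z \<in> W" if "W \<in> \<W>" "z \<in> ball (t W) r'" for W z
    using r0(2)[OF that(1)] that(2) by (auto simp: r'_def)
  define T where "T W s \<longleftrightarrow> homeomorphism UNIV UNIV (fst s) (snd s) \<and> (\<forall>x. x \<notin> W \<longrightarrow> fst s x = x) \<and>
      (\<forall>x\<in>X \<inter> W. k (fst s x) \<in> ball (t W) r')" for W and s :: "('a \<Rightarrow> 'a) \<times> ('a \<Rightarrow> 'a)"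
  have "\<exists>s. T W s" if W: "W \<in> \<W>" for W
  proof -
    have "disjoint \<W>" using disj unfolding disjoint_def by blast
    then have cpt: "compact (X \<inter> W)" using compact_Int_disjoint_cover[OF X(1) _ \<W>(2) \<W>(4) W] by blast
    have op: "open (k -` ball (t W) r')" using open_vimage[OF open_ball homeomorphism_cont1[OF k]] .
    have "w W \<in> k -` ball (t W) r'" using mw[OF W] r'(1) by (simp add: k_def)
    from cell_shrink[OF \<W>(2)[OF W] \<W>(3)[OF W] cpt inf_le2 w[OF W] op this]
    obtain s s' where "homeomorphism UNIV UNIV s s'" "\<forall>x. x \<notin> W \<longrightarrow> s x = x"
      "\<forall>x\<in>X \<inter> W. s x \<in> k -` ball (t W) r'"
      by (elim exE conjE)
    then have "T W (s, s')" unfolding T_def by simp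
    then show ?thesis by blast
  qed
  then obtain u where u: "\<And>W. W \<in> \<W> \<Longrightarrow> T W (u W)" by metis
  have u1: "\<And>W. W \<in> \<W> \<Longrightarrow> homeomorphism UNIV UNIV (fst (u W)) (snd (u W))"
    and u2: "\<And>W x. W \<in> \<W> \<Longrightarrow> x \<notin> W \<Longrightarrow> fst (u W) x = x"
    and u3: "\<And>W x. W \<in> \<W> \<Longrightarrow> x \<in> X \<inter> W \<Longrightarrow> k (fst (u W) x) \<in> ball (t W) r'"
    using u unfolding T_def by blast+
  have "\<exists>s s'. homeomorphism UNIV UNIV s s' \<and> (\<forall>W\<in>\<W>. \<forall>x\<in>W. s x = fst (u W) x) \<and>
    (\<forall>x. x \<notin> (\<Union>W\<in>\<W>. W) \<longrightarrow> s x = x) \<and> (\<forall>W\<in>\<W>. \<forall>x. s x \<in> W \<longleftrightarrow> x \<in> W)"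
    by (rule glue_homeomorphisms_support[OF \<W>(1)]) (fact u1 u2 disj)+
  then obtain s s' where s: "homeomorphism UNIV UNIV s s'" "\<forall>W\<in>\<W>. \<forall>x\<in>W. s x = fst (u W) x"
    "\<forall>x. x \<notin> (\<Union>W\<in>\<W>. W) \<longrightarrow> s x = x" "\<forall>W\<in>\<W>. \<forall>x. s x \<in> W \<longleftrightarrow> x \<in> W"
    by (elim exE conjE)
  have ss': "s (s' x) = x" for x using homeomorphism_apply2[OF s(1)] by simp
  have "stage X L (k \<circ> s) (s' \<circ> k') (t ` \<W>) r'"
    unfolding stage_def
  proof (intro conjI ballI impI)
    show "homeomorphism UNIV UNIV (k \<circ> s) (s' \<circ> k')" by (rule homeomorphism_compose[OF s(1) k])
    show "finite (t ` \<W>)" "t ` \<W> \<subseteq> L" "r' > 0" using \<W>(1) t(2) r'(1) by auto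
    show "ball a r' \<inter> ball b r' = {}" if ab: "a \<in> t ` \<W>" "b \<in> t ` \<W>" "a \<noteq> b" for a b
    proof -
      obtain V W where VW: "V \<in> \<W>" "W \<in> \<W>" "a = t V" "b = t W" using ab by blast
      then have "V \<inter> W = {}" using disj[of V W] ab(3) by blast
      then show ?thesis using into[OF VW(1)] into[OF VW(2)] VW(3,4) by blast
    qed
    show "(k \<circ> s) ` X \<subseteq> (\<Union>c\<in>t ` \<W>. ball c r')"
    proof
      fix y assume "y \<in> (k \<circ> s) ` X"
      then obtain x where x: "x \<in> X" "y = k (s x)" by auto
      then obtain W where W: "W \<in> \<W>" "x \<in> W" using \<W>(4) by blast
      then have "y \<in> ball (t W) r'" using u3[OF W(1), of x] s(2) W x by simp
      then show "y \<in> (\<Union>c\<in>t ` \<W>. ball c r')" using W(1) by blast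
    qed
  qed
  moreover have "small \<eta> ((s' \<circ> k') ` ball a r')" if a: "a \<in> t ` \<W>" for a
  proof -
    obtain W where W: "W \<in> \<W>" "a = t W" using a by blast
    have "(s' \<circ> k') ` ball a r' \<subseteq> W"
    proof
      fix y assume "y \<in> (s' \<circ> k') ` ball a r'"
      then obtain z where z: "z \<in> ball a r'" "y = s' (k' z)" by auto
      then have "s y \<in> W" using into[OF W(1)] W(2) ss' by simp
      then show "y \<in> W" using s(4) W(1) by simp
    qed
    moreover have "small \<eta> W" using \<V>(4) W(1) small_mono[of "min \<delta> \<eta>" W \<eta>] unfolding \<W>_def by simp
    ultimately show ?thesis using small_subset by blast
  qed
  moreover have "refines g F r (k \<circ> s)"
    unfolding refines_def
  proof (intro conjI allI impI ballI)
    fix x assume x: "x \<notin> (\<Union>c\<in>F. ball c r)"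
    have "g x \<notin> W" if "W \<in> \<W>" for W
      using c(1)[OF that] c(2)[OF that] hg[of x] x by auto
    then have "s (g x) = g x" using s(3) by simp
    then show "(k \<circ> s) (g x) = x" using m(3) x hg by (simp add: k_def)
  next
    fix d x assume d: "d \<in> F" "x \<in> ball d r"
    \<comment> \<open>\<open>s\<close> keeps \<open>g x\<close> in its cell, and \<open>h\<close>
      maps that whole cell into one old ball, which must be the ball of \<open>x\<close>.\<close>
    have "h (s (g x)) \<in> ball d r"
    proof (cases "g x \<in> (\<Union>W\<in>\<W>. W)")
      case True
      then obtain W where W: "W \<in> \<W>" "g x \<in> W" by blast
      then have "x \<in> ball (c W) r" using c(2)[OF W(1)] hg[of x] by auto
      then have "c W = d" using F(4)[OF c(1)[OF W(1)] d(1)] d(2) by blast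
      moreover have "s (g x) \<in> W" using s(4) W by simp
      ultimately show ?thesis using c(2)[OF W(1)] by blast
    next
      case False
      then show ?thesis using s(3) hg d(2) by simp
    qed
    then show "(k \<circ> s) (g x) \<in> ball d r" using m(4) d(1) by (simp add: k_def)
  qed
  ultimately show ?thesis using r'(2) by blast
qed

section \<open>Uniform limits of the stages\<close>

lemma uniform_limit_geometric:
  fixes f :: "nat \<Rightarrow> 'a \<Rightarrow> 'b::complete_space"
  assumes step: "\<And>n x. dist (f (Suc n) x) (f n x) \<le> M / 2 ^ n"
  obtains l where "uniform_limit UNIV f l sequentially"
proof -
  have M: "0 \<le> M" using step[of 0 undefined] zero_le_dist[of "f (Suc 0) undefined" "f 0 undefined"]
    by (simp del: zero_le_dist)
  \<comment> \<open>The partial geometric sum is kept exact, since with the bound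
    \<open>2 * M / 2 ^ n\<close> alone the induction would not close.\<close>
  have tail: "dist (f (n + k) x) (f n x) \<le> 2 * M / 2 ^ n - 2 * M / 2 ^ (n + k)" for n k x
  proof (induction k)
    case (Suc k)
    have "dist (f (n + Suc k) x) (f n x) \<le> dist (f (Suc (n + k)) x) (f (n + k) x) + dist (f (n + k) x) (f n x)"
      by (simp add: dist_triangle)
    also have "\<dots> \<le> M / 2 ^ (n + k) + (2 * M / 2 ^ n - 2 * M / 2 ^ (n + k))"
      using step Suc.IH by (rule add_mono)
    also have "\<dots> = 2 * M / 2 ^ n - 2 * M / 2 ^ (n + Suc k)" by (simp add: field_simps)
    finally show ?case .
  qed simp
  have bound: "dist (f m x) (f n x) \<le> 2 * M / 2 ^ n" if "n \<le> m" for m n x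
  proof -
    have "2 * M / 2 ^ m \<ge> 0" using M by simp
    then show ?thesis using tail[of n "m - n" x] that by simp
  qed
  have "(\<lambda>n. 2 * M / 2 ^ n) \<longlonglongrightarrow> 0"
    using tendsto_mult[OF tendsto_const[of "2 * M"] LIMSEQ_inverse_realpow_zero[of 2]] by (simp add: divide_inverse)
  have "uniformly_Cauchy_on UNIV f"
    unfolding uniformly_Cauchy_on_def
  proof (intro allI impI)
    fix \<epsilon> :: real assume "\<epsilon> > 0"
    then obtain N where N: "2 * M / 2 ^ N < \<epsilon>"
      using order_tendstoD(2)[OF \<open>_ \<longlonglongrightarrow> 0\<close>] eventually_sequentially by (metis order_refl)
    have "dist (f m x) (f n x) < \<epsilon>" if "N \<le> n" "n \<le> m" for m n x
    proof -
      have "2 * M / 2 ^ n \<le> 2 * M / 2 ^ N" using M that by (intro divide_left_mono power_increasing) auto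
      then show ?thesis using bound[OF that(2), of x] N by linarith
    qed
    then show "\<exists>N. \<forall>x\<in>UNIV. \<forall>m\<ge>N. \<forall>n\<ge>N. dist (f m x) (f n x) < \<epsilon>"
      by (metis dist_commute nle_le)
  qed
  then show ?thesis
    using that uniformly_convergent_eq_Cauchy unfolding uniformly_convergent_on_def by blast
qed

text \<open>Applied with \<open>y n\<close> the image of a point under the other sequence, this
  carries the relations \<open>h n (g n z) = z\<close> and \<open>g n (h n z) = z\<close> over to
  the limits.\<close>

lemma uniform_limit_diagonal:
  fixes f :: "nat \<Rightarrow> 'a::topological_space \<Rightarrow> 'b::metric_space"
  assumes ul: "uniform_limit UNIV f l sequentially" and cont: "continuous_on UNIV l" and y: "y \<longlonglongrightarrow> z"
  shows "(\<lambda>n. f n (y n)) \<longlonglongrightarrow> l z"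
proof (rule tendstoI)
  fix \<epsilon> :: real assume "\<epsilon> > 0"
  have "(\<lambda>n. l (y n)) \<longlonglongrightarrow> l z"
    using continuous_on_tendsto_compose[OF cont y] by simp
  then have "\<forall>\<^sub>F n in sequentially. dist (l (y n)) (l z) < \<epsilon> / 2"
    by (rule tendstoD) (use \<open>\<epsilon> > 0\<close> in simp)
  moreover have "\<forall>\<^sub>F n in sequentially. \<forall>x\<in>UNIV. dist (f n x) (l x) < \<epsilon> / 2"
    using uniform_limitD[OF ul half_gt_zero[OF \<open>\<epsilon> > 0\<close>]] .
  ultimately show "\<forall>\<^sub>F n in sequentially. dist (f n (y n)) (l z) < \<epsilon>"
    by eventually_elim (metis UNIV_I dist_triangle_half_r dist_commute)
qed

text \<open>A uniform limit of homeomorphisms need not be injective; it is here because the inverses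
  converge uniformly as well. The shrinking radii bring the image of \<open>X\<close> onto the
  closed set \<open>L\<close>.\<close>

lemma tame_of_fine_cover_cell:
  fixes X :: "'a::euclidean_space set"
  assumes dim: "2 \<le> DIM('a)" and X: "compact X" "fine_cover cell X"
  shows "tame X"
proof -
  obtain b :: 'a where b: "b \<in> Basis" using nonempty_Basis by blast
  define L where "L = span {b}"
  have b0: "b \<noteq> 0" "norm b = 1" using b nonzero_Basis by auto
  have L: "affine L" "aff_dim L = 1" "closed L"
    using b0(1) by (simp_all add: L_def subspace_imp_affine aff_dim_subspace closed_subspace)
  have inf: "infinite (L \<inter> ball c r)" if "c \<in> L" "r > 0" for c r
  proof -
    have "(\<lambda>t. c + t *\<^sub>R b) ` {0<..<r} \<subseteq> L \<inter> ball c r"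
    proof (clarify, intro IntI)
      fix t :: real assume "t \<in> {0<..<r}"
      then show "c + t *\<^sub>R b \<in> ball c r" using b0(2) by (simp add: dist_norm)
      have "t *\<^sub>R b \<in> L" unfolding L_def by (intro span_scale span_base) simp
      then show "c + t *\<^sub>R b \<in> L" using \<open>c \<in> L\<close> span_add unfolding L_def by blast
    qed
    moreover have "infinite ((\<lambda>t. c + t *\<^sub>R b) ` {0<..<r})"
      using that(2) b0(1) by (subst finite_image_iff) (auto simp: inj_on_def infinite_Ioo)
    ultimately show ?thesis using finite_subset by blast
  qed
  obtain R where R: "R > 0" "X \<subseteq> ball 0 R"
    using bounded_subset_ballD[OF compact_imp_bounded[OF X(1)], of 0] by blast
  \<comment> \<open>Stage 0 is the identity with the single ball of radius \<open>R\<close> about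
    the origin, whose points are less than \<open>2 * R\<close> apart.\<close>
  define M where "M = 2 * R"
  have M: "M > 0" using R by (simp add: M_def)
  define good where "good n t \<longleftrightarrow> (case t of (h, g, F, r) \<Rightarrow> stage X L h g F r \<and> r \<le> M / 2 ^ n \<and>
      (\<forall>c\<in>F. small (M / 2 ^ n) (g ` ball c r)))" for n :: nat and t :: "('a \<Rightarrow> 'a) \<times> ('a \<Rightarrow> 'a) \<times> 'a set \<times> real"
  define next_stage where "next_stage t t' \<longleftrightarrow> (case t of (h, g, F, r) \<Rightarrow> refines g F r (fst t'))"
    for t t' :: "('a \<Rightarrow> 'a) \<times> ('a \<Rightarrow> 'a) \<times> 'a set \<times> real"
  have "\<exists>t. good 0 t"
  proof
    have "stage X L (\<lambda>x. x) (\<lambda>x. x) {0} R"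
      unfolding stage_def using R by (simp add: L_def span_zero homeomorphism_ident)
    moreover have "small M (ball (0::'a) R)"
      unfolding small_def
    proof (intro ballI)
      fix x y :: 'a assume "x \<in> ball 0 R" "y \<in> ball 0 R"
      then show "dist x y < M" using norm_triangle_ineq4[of x y] by (simp add: dist_norm M_def)
    qed
    ultimately show "good 0 (\<lambda>x. x, \<lambda>x. x, {0}, R)"
      unfolding good_def using R(1) by (simp add: M_def)
  qed
  moreover have "\<exists>t'. good (Suc n) t' \<and> next_stage t t'" if "good n t" for n t
  proof -
    obtain h g F r where t: "t = (h, g, F, r)" by (cases t)
    have "stage X L h g F r" "M / 2 ^ Suc n > 0" using that M unfolding t good_def by simp_all
    from stage_refine[OF dim X inf this]
    obtain h' g' F' r' where "stage X L h' g' F' r'" "r' \<le> M / 2 ^ Suc n"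
      "\<forall>c\<in>F'. small (M / 2 ^ Suc n) (g' ` ball c r')" "refines g F r h'"
      by blast
    then have "good (Suc n) (h', g', F', r') \<and> next_stage t (h', g', F', r')"
      unfolding good_def next_stage_def t by simp
    then show ?thesis by blast
  qed
  ultimately obtain T where T: "\<And>n. good n (T n)" "\<And>n. next_stage (T n) (T (Suc n))"
    using dependent_nat_choice[of good "\<lambda>_. next_stage"] by metis
  define h where "h n = fst (T n)" for n
  define g where "g n = fst (snd (T n))" for n
  define F where "F n = fst (snd (snd (T n)))" for n
  define r where "r n = snd (snd (snd (T n)))" for n
  have T_eq: "T n = (h n, g n, F n, r n)" for n by (simp add: h_def g_def F_def r_def)
  have st: "stage X L (h n) (g n) (F n) (r n)" and rn: "r n \<le> M / 2 ^ n"
    and sm: "\<And>c. c \<in> F n \<Longrightarrow> small (M / 2 ^ n) (g n ` ball c (r n))" for n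
    using T(1)[of n] unfolding T_eq good_def by simp_all
  have ref: "refines (g n) (F n) (r n) (h (Suc n))" for n
    using T(2)[of n] unfolding T_eq next_stage_def by simp
  have hom: "homeomorphism UNIV UNIV (h n) (g n)" for n using st[of n] unfolding stage_def by blast
  have hg: "h n (g n x) = x" and gh: "g n (h n x) = x" for n x
    using homeomorphism_apply1[OF hom] homeomorphism_apply2[OF hom] by auto
  have step_h: "dist (h (Suc n) x) (h n x) \<le> 2 * M / 2 ^ n" for n x
  proof (cases "h n x \<in> (\<Union>c\<in>F n. ball c (r n))")
    case True
    then obtain c where c: "c \<in> F n" "h n x \<in> ball c (r n)" by blast
    then have "h (Suc n) (g n (h n x)) \<in> ball c (r n)" using ref[of n] unfolding refines_def by blast
    then have "dist c (h (Suc n) x) < r n" by (simp add: gh)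
    then show ?thesis using c(2) rn[of n] dist_triangle3[of "h (Suc n) x" "h n x" c] by simp
  next
    case False
    then have "h (Suc n) (g n (h n x)) = h n x" using ref[of n] unfolding refines_def by blast
    then show ?thesis using M by (simp add: gh)
  qed
  have step_g: "dist (g (Suc n) z) (g n z) \<le> 2 * M / 2 ^ n" for n z
  proof -
    \<comment> \<open>Both inverses are compared through \<open>g n\<close>: the transition map
      sends \<open>u\<close> to \<open>z\<close>, so either the two points coincide or they share an
      old ball, whose image under \<open>g n\<close> is small.\<close>
    define u where "u = h n (g (Suc n) z)"
    have u: "g (Suc n) z = g n u" "h (Suc n) (g n u) = z" by (simp_all add: u_def gh hg)
    have pos: "0 \<le> M / 2 ^ n" using M by simp
    show ?thesis
    proof (cases "u \<in> (\<Union>c\<in>F n. ball c (r n))")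
      case True
      then obtain c where c: "c \<in> F n" "u \<in> ball c (r n)" by blast
      then have "z \<in> ball c (r n)" using ref[of n] u(2) unfolding refines_def by metis
      then have "dist (g n u) (g n z) < M / 2 ^ n" using sm[OF c(1)] c(2) unfolding small_def by blast
      then show ?thesis using pos by (simp add: u(1))
    next
      case False
      then have "z = u" using ref[of n] u(2) unfolding refines_def by metis
      then show ?thesis unfolding u(1) using pos by simp
    qed
  qed
  obtain H where H: "uniform_limit UNIV h H sequentially" using uniform_limit_geometric[OF step_h] .
  obtain G where G: "uniform_limit UNIV g G sequentially" using uniform_limit_geometric[OF step_g] .
  have contH: "continuous_on UNIV H" and contG: "continuous_on UNIV G"
    using uniform_limit_theorem[OF _ H] uniform_limit_theorem[OF _ G] homeomorphism_cont1[OF hom] homeomorphism_cont2[OF hom]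
    by simp_all
  have HG: "H (G z) = z" and GH: "G (H z) = z" for z
  proof -
    have "(\<lambda>n. h n (g n z)) \<longlonglongrightarrow> H (G z)"
      using uniform_limit_diagonal[OF H contH] tendsto_uniform_limitI[OF G] by blast
    then show "H (G z) = z" by (simp add: hg LIMSEQ_const_iff)
    have "(\<lambda>n. g n (h n z)) \<longlonglongrightarrow> G (H z)"
      using uniform_limit_diagonal[OF G contG] tendsto_uniform_limitI[OF H] by blast
    then show "G (H z) = z" by (simp add: gh LIMSEQ_const_iff)
  qed
  have "homeomorphism UNIV UNIV H G"
    by (rule homeomorphismI[OF contH contG]) (simp_all add: HG GH)
  moreover have "H ` X \<subseteq> L"
  proof
    fix y assume "y \<in> H ` X"
    then obtain x where x: "x \<in> X" "y = H x" by blast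
    have "infdist (h n x) L \<le> M / 2 ^ n" for n
    proof -
      have "h n x \<in> (\<Union>c\<in>F n. ball c (r n))" "F n \<subseteq> L" using st[of n] x(1) unfolding stage_def by blast+
      then obtain c where "c \<in> L" "dist c (h n x) < r n" by auto
      then show ?thesis using infdist_le[of c L "h n x"] rn[of n] by (simp add: dist_commute)
    qed
    moreover have "(\<lambda>n. infdist (h n x) L) \<longlonglongrightarrow> infdist y L"
      unfolding x(2) by (intro tendsto_infdist tendsto_uniform_limitI[OF H]) simp
    moreover have "(\<lambda>n. M / 2 ^ n) \<longlonglongrightarrow> 0"
      using tendsto_mult[OF tendsto_const[of M] LIMSEQ_inverse_realpow_zero[of 2]] by (simp add: divide_inverse)
    ultimately have "infdist y L \<le> 0" by (meson LIMSEQ_le)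
    then have "infdist y L = 0" using infdist_nonneg[of y L] by linarith
    moreover have "L \<noteq> {}" using span_zero unfolding L_def by blast
    ultimately show "y \<in> L" using in_closed_iff_infdist_zero[OF L(3)] by blast
  qed
  ultimately show ?thesis unfolding tame_def using L(1,2) by blast
qed

section \<open>Projections\<close>

text \<open>\<open>q\<close> is the adjoint of an isometric embedding onto \<open>S\<close>, so
  \<open>e \<circ> q\<close> is the orthogonal projection onto \<open>S\<close>; both norm bounds
  are Cauchy-Schwarz.\<close>

lemma splitting_of_subspace:
  fixes S :: "'a::euclidean_space set"
  assumes "subspace S" "dim S = DIM('b::euclidean_space)"
  obtains e :: "'b::euclidean_space \<Rightarrow> 'a" and q where "splitting e q" "range e = S" "\<And>x v. (x - e (q x)) \<bullet> e v = 0"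
proof -
  obtain e :: "'b \<Rightarrow> 'a" where e: "linear e" "e ` UNIV = S" "\<And>x. x \<in> UNIV \<Longrightarrow> norm (e x) = norm x"
    using isometry_subspaces[of "UNIV :: 'b set" S] assms by (metis dim_UNIV subspace_UNIV)
  have inner_e: "e v \<bullet> e w = v \<bullet> w" for v w
    unfolding dot_norm linear_add[OF e(1), symmetric] using e(3) by simp
  define q where "q = adjoint e"
  have q: "q x \<bullet> v = x \<bullet> e v" for x v
    using adjoint_works[OF e(1), of v x] by (simp add: q_def inner_commute)
  have qe: "q (e v) = v" for v
    by (rule vector_eq_rdot[THEN iffD1]) (simp add: q inner_e)
  have orth: "(x - e (q x)) \<bullet> e v = 0" for x v
    using q[of x v] by (simp add: inner_diff_left inner_e)
  have nq: "norm (q x) \<le> norm x" for x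
  proof -
    have "norm (q x) * norm (q x) = x \<bullet> e (q x)" using q[of x "q x"] by (simp add: power2_norm_eq_inner[symmetric] power2_eq_square)
    also have "\<dots> \<le> norm x * norm (q x)" using norm_cauchy_schwarz[of x "e (q x)"] e(3) by simp
    finally show ?thesis by (cases "q x = 0") (simp_all add: mult_le_cancel_right)
  qed
  have nr: "norm (x - e (q x)) \<le> norm x" for x
  proof -
    have "norm (x - e (q x)) * norm (x - e (q x)) = (x - e (q x)) \<bullet> x"
      using orth[of x "q x"] by (simp add: inner_diff_right power2_norm_eq_inner[symmetric] power2_eq_square[symmetric]) (simp add: power2_norm_eq_inner inner_diff_right)
    also have "\<dots> \<le> norm (x - e (q x)) * norm x" by (rule norm_cauchy_schwarz)
    finally show ?thesis by (cases "x - e (q x) = 0") (simp_all add: mult_le_cancel_left)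
  qed
  have "splitting e q"
    using e(1,3) qe nq nr by (intro splitting.intro) (simp_all add: q_def adjoint_linear)
  then show ?thesis using that e(2) orth by blast
qed

context splitting
begin

text \<open>The zero-dimensional projection goes to the factor with the cells, so the cells form the
  base and the sets \<open>M\<close> come from the fibres, which \<open>\<rho>\<close> embeds. The
  resulting pairs are therefore swapped.\<close>

lemma fine_cover_cell_of_base:
  assumes cells: "\<And>K :: 'b set. compact K \<Longrightarrow> fine_cover (\<lambda>_. True) K \<Longrightarrow> fine_cover cell K"
    and X: "compact X" "fine_cover (\<lambda>_. True) X" and base: "fine_cover (\<lambda>_. True) (q ` X)"
  shows "fine_cover cell X"
proof (rule fine_cover_cell_of_cylinders[OF X(1)])
  fix d :: real assume d: "d > 0"
  have cont: "continuous_on X q" "continuous_on X \<rho>" by (intro continuous_q continuous_\<rho> continuous_on_id)+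
  have "fine_cover cell (q ` X)" by (rule cells[OF compact_continuous_image[OF cont(1) X(1)] base])
  then show "\<exists>I. finite I \<and> (\<forall>(M, V)\<in>I. open M \<and> small d M \<and> open V \<and> small d V \<and> cell V) \<and>
      (\<forall>(M, V)\<in>I. \<forall>(M', V')\<in>I. (M, V) \<noteq> (M', V') \<longrightarrow> M \<inter> M' = {} \<or> V \<inter> V' = {}) \<and>
      X \<subseteq> (\<Union>(M, V)\<in>I. cyl M V)"
  proof (rule product_cover[OF X(1) cont d])
    fix y assume "y \<in> q ` X"
    have "closedin (top_of_set X) (X \<inter> q -` {y})" by (rule continuous_closedin_preimage[OF cont(1) closed_singleton])
    then have cpt: "compact {x \<in> X. q x = y}" using closedin_compact[OF X(1)] by (simp add: vimage_def Int_def)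
    have sub: "{x \<in> X. q x = y} \<subseteq> X" by blast
    have "inj_on \<rho> {x \<in> X. q x = y}"
      by (rule inj_onI) (metis (mono_tags, lifting) decomp mem_Collect_eq)
    then show "fine_cover (\<lambda>_. True) (\<rho> ` {x \<in> X. q x = y})"
      by (rule fine_cover_inj_image[OF cpt fine_cover_subset[OF X(2) sub] continuous_on_subset[OF cont(2) sub]])
  next
    fix I assume I: "finite I"
      "\<And>A B. (A, B) \<in> I \<Longrightarrow> open A \<and> small d A \<and> cell A \<and> open B \<and> small d B \<and> True"
      "\<And>A B A' B'. (A, B) \<in> I \<Longrightarrow> (A', B') \<in> I \<Longrightarrow> (A, B) \<noteq> (A', B') \<Longrightarrow> A \<inter> A' = {} \<or> B \<inter> B' = {}"
      "\<And>x. x \<in> X \<Longrightarrow> \<exists>(A, B)\<in>I. q x \<in> A \<and> \<rho> x \<in> B"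
    let ?J = "{(M, V). (V, M) \<in> I}"
    have "?J = prod.swap ` I" by force
    then have "finite ?J" using I(1) by simp
    moreover have "\<forall>(M, V)\<in>?J. open M \<and> small d M \<and> open V \<and> small d V \<and> cell V" using I(2) by blast
    moreover have "\<forall>(M, V)\<in>?J. \<forall>(M', V')\<in>?J. (M, V) \<noteq> (M', V') \<longrightarrow> M \<inter> M' = {} \<or> V \<inter> V' = {}"
      using I(3) by blast
    moreover have "X \<subseteq> (\<Union>(M, V)\<in>?J. cyl M V)"
    proof
      fix x assume "x \<in> X"
      then obtain A B where "(A, B) \<in> I" "q x \<in> A" "\<rho> x \<in> B" using I(4) by blast
      then show "x \<in> (\<Union>(M, V)\<in>?J. cyl M V)" unfolding cyl_def by blast
    qed
    ultimately show ?thesis by blast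
  qed
qed

text \<open>Now the zero-dimensional projection goes to the factor where no cells are required; the
  fibres, embedded by \<open>q\<close>, supply them.\<close>

lemma fine_cover_cell_of_fibres:
  assumes cells: "\<And>K :: 'b set. compact K \<Longrightarrow> fine_cover (\<lambda>_. True) K \<Longrightarrow> fine_cover cell K"
    and X: "compact X" "fine_cover (\<lambda>_. True) X" and base: "fine_cover (\<lambda>_. True) (\<rho> ` X)"
  shows "fine_cover cell X"
proof (rule fine_cover_cell_of_cylinders[OF X(1)])
  fix d :: real assume d: "d > 0"
  have cont: "continuous_on X \<rho>" "continuous_on X q" by (intro continuous_q continuous_\<rho> continuous_on_id)+
  show "\<exists>I. finite I \<and> (\<forall>(M, V)\<in>I. open M \<and> small d M \<and> open V \<and> small d V \<and> cell V) \<and>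
      (\<forall>(M, V)\<in>I. \<forall>(M', V')\<in>I. (M, V) \<noteq> (M', V') \<longrightarrow> M \<inter> M' = {} \<or> V \<inter> V' = {}) \<and>
      X \<subseteq> (\<Union>(M, V)\<in>I. cyl M V)"
  proof (rule product_cover[OF X(1) cont d base])
    fix y assume "y \<in> \<rho> ` X"
    have "closedin (top_of_set X) (X \<inter> \<rho> -` {y})" by (rule continuous_closedin_preimage[OF cont(1) closed_singleton])
    then have cpt: "compact {x \<in> X. \<rho> x = y}" using closedin_compact[OF X(1)] by (simp add: vimage_def Int_def)
    have sub: "{x \<in> X. \<rho> x = y} \<subseteq> X" by blast
    note cq = continuous_on_subset[OF cont(2) sub]
    have "inj_on q {x \<in> X. \<rho> x = y}"
      by (rule inj_onI) (metis (mono_tags, lifting) decomp mem_Collect_eq)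
    from cells[OF compact_continuous_image[OF cq cpt] fine_cover_inj_image[OF cpt fine_cover_subset[OF X(2) sub] cq this]]
    show "fine_cover cell (q ` {x \<in> X. \<rho> x = y})" .
  next
    fix I assume I: "finite I"
      "\<And>A B. (A, B) \<in> I \<Longrightarrow> open A \<and> small d A \<and> True \<and> open B \<and> small d B \<and> cell B"
      "\<And>A B A' B'. (A, B) \<in> I \<Longrightarrow> (A', B') \<in> I \<Longrightarrow> (A, B) \<noteq> (A', B') \<Longrightarrow> A \<inter> A' = {} \<or> B \<inter> B' = {}"
      "\<And>x. x \<in> X \<Longrightarrow> \<exists>(A, B)\<in>I. \<rho> x \<in> A \<and> q x \<in> B"
    have "\<forall>(M, V)\<in>I. open M \<and> small d M \<and> open V \<and> small d V \<and> cell V" using I(2) by blast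
    moreover have "\<forall>(M, V)\<in>I. \<forall>(M', V')\<in>I. (M, V) \<noteq> (M', V') \<longrightarrow> M \<inter> M' = {} \<or> V \<inter> V' = {}"
      using I(3) by blast
    moreover have "X \<subseteq> (\<Union>(M, V)\<in>I. cyl M V)"
    proof
      fix x assume "x \<in> X"
      then obtain A B where "(A, B) \<in> I" "\<rho> x \<in> A" "q x \<in> B" using I(4) by blast
      then show "x \<in> (\<Union>(M, V)\<in>I. cyl M V)" unfolding cyl_def by blast
    qed
    ultimately show ?thesis using I(1) by blast
  qed
qed

end

text \<open>The two cases of \<open>dim\<close> differ in what the range of \<open>e\<close> is: the
  direction space of \<open>P\<close> or its orthogonal complement. Up to a map that is injective on
  the image of \<open>X\<close>, the projection to \<open>P\<close> is then \<open>q\<close> or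
  \<open>\<rho>\<close>, and fine covers survive such maps.\<close>

lemma fine_cover_cell_proj:
  fixes X P :: "'a::euclidean_space set"
  assumes cells: "\<And>K :: 'b::euclidean_space set. compact K \<Longrightarrow> fine_cover (\<lambda>_. True) K \<Longrightarrow> fine_cover cell K"
    and X: "compact X" "fine_cover (\<lambda>_. True) X"
    and P: "affine P" "P \<noteq> {}" and proj: "fine_cover (\<lambda>_. True) (orth_proj P ` X)"
    and dim: "aff_dim P = int DIM('b) \<or> aff_dim P = int DIM('a) - int DIM('b)"
  shows "fine_cover cell X"
proof -
  obtain a where a: "a \<in> P" using P(2) by blast
  define S where "S = (\<lambda>x. - a + x) ` P"
  have S: "subspace S" using affine_diffs_subspace[OF P(1) a] by (simp add: S_def)
  have dS: "aff_dim P = int (dim S)" using aff_dim_eq_dim[OF hull_inc[OF a]] by (simp add: S_def)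
  have inP: "a + s \<in> P" if "s \<in> S" for s using that by (auto simp: S_def)
  have inS: "z - a \<in> S" if "z \<in> P" for z using that by (auto simp: S_def)
  have orth: "orth_proj P x = a + s" if "s \<in> S" "\<And>w. w \<in> S \<Longrightarrow> (x - a - s) \<bullet> w = 0" for x s
  proof (rule orth_proj_eqI[OF inP[OF that(1)]])
    fix z assume "z \<in> P"
    then have "z - (a + s) \<in> S" using subspace_diff[OF S inS that(1)] by (simp add: algebra_simps)
    then show "orthogonal (x - (a + s)) (z - (a + s))"
      using that(2) by (simp add: orthogonal_def diff_diff_eq)
  qed
  from dim show ?thesis
  proof
    assume "aff_dim P = int DIM('b)"
    then obtain e :: "'b \<Rightarrow> 'a" and q where eq: "splitting e q" "range e = S" "\<And>x v. (x - e (q x)) \<bullet> e v = 0"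
      using splitting_of_subspace[OF S] dS by (metis of_nat_eq_iff)
    interpret splitting e q by (rule eq(1))
    have pr: "orth_proj P x = a + e (q (x - a))" for x
      using eq(2,3) by (intro orth) auto
    have cpt: "compact (orth_proj P ` X)"
      unfolding pr by (intro compact_continuous_image X(1) continuous_on_add continuous_on_const continuous_e continuous_q continuous_on_diff continuous_on_id)
    have img: "(\<lambda>y. q (y - a) + q a) ` orth_proj P ` X = q ` X"
      by (simp add: image_image pr lin_simps)
    have "fine_cover (\<lambda>_. True) ((\<lambda>y. q (y - a) + q a) ` orth_proj P ` X)"
    proof (rule fine_cover_inj_image[OF cpt proj])
      show "continuous_on (orth_proj P ` X) (\<lambda>y. q (y - a) + q a)"
        by (intro continuous_on_add continuous_on_const continuous_q continuous_on_diff continuous_on_id)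
      show "inj_on (\<lambda>y. q (y - a) + q a) (orth_proj P ` X)"
        by (auto simp: inj_on_def pr)
    qed
    then have "fine_cover (\<lambda>_. True) (q ` X)" unfolding img .
    from fine_cover_cell_of_base[OF _ X this] cells show ?thesis by blast
  next
    assume codim: "aff_dim P = int DIM('a) - int DIM('b)"
    define N where "N = {y \<in> UNIV. \<forall>x\<in>S. orthogonal x y}"
    have "dim N + dim S = DIM('a)"
      unfolding N_def using dim_subspace_orthogonal_to_vectors[OF S subspace_UNIV] by simp
    then have "dim N = DIM('b)" using codim dS by linarith
    moreover have N: "subspace N" unfolding N_def using subspace_orthogonal_to_vectors[of S] by simp
    ultimately obtain e :: "'b \<Rightarrow> 'a" and q where eq: "splitting e q" "range e = N" "\<And>x v. (x - e (q x)) \<bullet> e v = 0"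
      using splitting_of_subspace[of N] by metis
    interpret splitting e q by (rule eq(1))
    have pr: "orth_proj P x = a + \<rho> (x - a)" for x
    proof (rule orth)
      \<comment> \<open>\<open>\<rho>\<close> removes the component in \<open>N\<close>; the
        decomposition along \<open>S\<close> identifies what remains with the component in
        \<open>S\<close>.\<close>
      obtain y z where yz: "y \<in> span S" "\<And>w. w \<in> span S \<Longrightarrow> orthogonal z w" "x - a = y + z"
        by (rule orthogonal_subspace_decomp_exists[of S "x - a"]) blast
      have sp: "span S = S" using S by (simp add: span_eq_iff)
      have "z \<in> N" using yz(2) by (simp add: N_def sp orthogonal_commute)
      then obtain v where v: "z = e v" using eq(2) by blast
      have "e (q y) \<in> N" using eq(2) by blast
      then have "y \<bullet> e (q y) = 0" using yz(1) by (simp add: N_def sp orthogonal_def)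
      moreover have "(y - e (q y)) \<bullet> e (q y) = 0" by (rule eq(3))
      ultimately have "e (q y) = 0" by (simp add: inner_diff_left)
      then have "\<rho> (x - a) = y" unfolding yz(3) v by (simp add: \<rho>_def lin_simps)
      then show "\<rho> (x - a) \<in> S" using yz(1) sp by simp
      have "x - a - \<rho> (x - a) = e (q (x - a))" by (simp add: \<rho>_def)
      moreover have "e (q (x - a)) \<in> N" using eq(2) by blast
      ultimately show "(x - a - \<rho> (x - a)) \<bullet> w = 0" if "w \<in> S" for w
        using that by (simp add: N_def orthogonal_def inner_commute)
    qed
    have cpt: "compact (orth_proj P ` X)"
      unfolding pr by (intro compact_continuous_image X(1) continuous_on_add continuous_on_const continuous_\<rho> continuous_on_diff continuous_on_id)
    have img: "(\<lambda>y. y - a + \<rho> a) ` orth_proj P ` X = \<rho> ` X"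
      by (simp add: image_image pr lin_simps)
    have "fine_cover (\<lambda>_. True) ((\<lambda>y. y - a + \<rho> a) ` orth_proj P ` X)"
    proof (rule fine_cover_inj_image[OF cpt proj])
      show "continuous_on (orth_proj P ` X) (\<lambda>y. y - a + \<rho> a)"
        by (intro continuous_intros)
    qed (simp add: inj_on_def)
    then have "fine_cover (\<lambda>_. True) (\<rho> ` X)" unfolding img .
    from fine_cover_cell_of_fibres[OF _ X this] cells show ?thesis by blast
  qed
qed

theorem theorem6p1:
  fixes X P :: "(real ^ 'n) set"
  assumes "CARD('n) \<ge> 2"
    and "compact X"
    and "zero_dimensional X"
    and "affine P"
    and "aff_dim P \<in> {1, 2, int CARD('n) - 2, int CARD('n) - 1}"
    and "zero_dimensional (orth_proj P ` X)"
  shows "tame X"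
proof -
  \<comment> \<open>The empty set has affine dimension -1, which equals \<open>n - 2\<close> for
    \<open>n = 1\<close>; the bound \<open>n \<ge> 2\<close> excludes it.\<close>
  have "P \<noteq> {}" using assms(1,5) by (auto simp: aff_dim_empty_eq)
  have "compact (orth_proj P ` X)"
  proof -
    have "continuous_on X (closest_point P)"
      using continuous_on_closest_point[OF affine_imp_convex[OF assms(4)] affine_closed[OF assms(4)] \<open>P \<noteq> {}\<close>] .
    then have "continuous_on X (orth_proj P)"
      using orth_proj_eq_closest_point[OF assms(4) \<open>P \<noteq> {}\<close>] by (simp cong: continuous_on_cong)
    then show ?thesis using assms(2) by (rule compact_continuous_image)
  qed
  then have proj: "fine_cover (\<lambda>_. True) (orth_proj P ` X)"
    using assms(6) by (rule zero_dimensional_imp_fine_cover)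
  have X: "fine_cover (\<lambda>_. True) X" using assms(2,3) by (rule zero_dimensional_imp_fine_cover)
  \<comment> \<open>Dimensions 1 and \<open>n - 1\<close> take their cells from the real line, 2 and
    \<open>n - 2\<close> from the complex plane.\<close>
  have "(aff_dim P = int DIM(real) \<or> aff_dim P = int DIM(real ^ 'n) - int DIM(real)) \<or>
    (aff_dim P = int DIM(complex) \<or> aff_dim P = int DIM(real ^ 'n) - int DIM(complex))"
    using assms(5) by auto
  then have "fine_cover cell X"
    using fine_cover_cell_proj[OF fine_cover_cell_real assms(2) X assms(4) \<open>P \<noteq> {}\<close> proj]
      fine_cover_cell_proj[OF fine_cover_cell_complex assms(2) X assms(4) \<open>P \<noteq> {}\<close> proj] by blast
  then show ?thesis
    using assms(1,2) by (intro tame_of_fine_cover_cell) simp_all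
qed

end
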